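(* There exist bounded simply connected domains in $\mathbb{C}$ which have the Denjoy-Wolff Property and are not visible.
   Context: For a domain $\Omega\subset\mathbb{C}$, $\partial\Omega$ denotes its boundary in the Riemann sphere $\mathbb{C}_\infty$ (the Euclidean boundary if $\Omega$ is bounded). A simply connected domain $\Omega$ has the Denjoy-Wolff Property if for every holomorphic $f:\Omega\to\Omega$ without fixed points in $\Omega$ there is $\tau\in\partial\Omega$ such that the iterates $f^{\circ n}$ converge to $\tau$ uniformly on compacta of $\Omega$ (as maps into $\mathbb{C}_\infty$). Let $\Omega\subsetneq\mathbb{C}$ be simply connected, endowed with its hyperbolic (Poincaré) metric. A geodesic segment in $\Omega$ is a curve $\gamma:[0,R]\to\Omega$, $R\in(0,+\infty)$, which minimizes the hyperbolic length between $\gamma(s)$ and $\gamma(t)$ for every $s,t\in[0,R]$. The domain $\Omega$ is visible if for any two points $p,q\in\partial\Omega$ with $p\neq q$ there exists a compact set $K\subset\Omega$ such that, for every sequence of geodesic segments $\gamma_n:[0,R_n]\to\Omega$ with $\gamma_n(0)\to p$ and $\gamma_n(R_n)\to q$, one has $\gamma_n([0,R_n])\cap K\neq\emptyset$ for all $n$ sufficiently large. *)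

theory Defs
  imports "HOL-Complex_Analysis.Complex_Analysis"
begin

(* The Riemann sphere is the unit sphere of complex * real with the chordal (Euclidean) metric;
   the plane sits in it by stereographic projection from the north pole (0, 1), which is the
   point at infinity. *)
definition riemann_sphere :: "(complex \<times> real) set"
  where "riemann_sphere = sphere 0 1"

definition to_sphere :: "complex \<Rightarrow> complex \<times> real"
  where "to_sphere z =
    (2 * z / of_real (1 + (norm z)\<^sup>2), ((norm z)\<^sup>2 - 1) / ((norm z)\<^sup>2 + 1))"

definition sphere_boundary :: "complex set \<Rightarrow> (complex \<times> real) set"
  where "sphere_boundary \<Omega> = (top_of_set riemann_sphere) frontier_of (to_sphere ` \<Omega>)"

definition denjoy_wolff_property :: "complex set \<Rightarrow> bool"
  where "denjoy_wolff_property \<Omega> \<longleftrightarrow>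
    (\<forall>f. f holomorphic_on \<Omega> \<and> f ` \<Omega> \<subseteq> \<Omega> \<and> (\<forall>z\<in>\<Omega>. f z \<noteq> z) \<longrightarrow>
      (\<exists>\<tau>\<in>sphere_boundary \<Omega>. \<forall>K. compact K \<and> K \<subseteq> \<Omega> \<longrightarrow>
        uniform_limit K (\<lambda>n z. to_sphere ((f ^^ n) z)) (\<lambda>_. \<tau>) sequentially))"

definition riemann_map :: "complex set \<Rightarrow> (complex \<Rightarrow> complex) \<Rightarrow> bool"
  where "riemann_map \<Omega> g \<longleftrightarrow> g holomorphic_on \<Omega> \<and> bij_betw g \<Omega> (ball 0 1)"

(* Density of the Poincare metric (curvature -1) of a simply connected domain other than the
   whole plane: the pull-back of 2 |dz| / (1 - |z|^2) under a Riemann map.  A Riemann map exists by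
   the Riemann mapping theorem, and the value does not depend on which one is chosen, because the
   automorphisms of the disc are isometries of its Poincare metric. *)
definition hyperbolic_density :: "complex set \<Rightarrow> complex \<Rightarrow> real"
  where "hyperbolic_density \<Omega> z =
    (let g = (SOME g. riemann_map \<Omega> g) in 2 * norm (deriv g z) / (1 - (norm (g z))\<^sup>2))"

(* The length is an extended nonnegative real: in the library's piecewise C^1 curves the derivative
   may be unbounded near the exceptional points, so that a curve can have infinite length (which
   the Henstock-Kurzweil or Bochner integral would record as 0). *)
definition hyperbolic_length :: "complex set \<Rightarrow> (real \<Rightarrow> complex) \<Rightarrow> real \<Rightarrow> real \<Rightarrow> ennreal"
  where "hyperbolic_length \<Omega> \<gamma> s t =
    (\<integral>\<^sup>+u\<in>{s..t}. ennreal (hyperbolic_density \<Omega> (\<gamma> u) * norm (vector_derivative \<gamma> (at u))) \<partial>lborel)"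

(* The segment and its competitors (valid_path) are piecewise C^1 curves. *)
definition geodesic_segment :: "complex set \<Rightarrow> real \<Rightarrow> (real \<Rightarrow> complex) \<Rightarrow> bool"
  where "geodesic_segment \<Omega> R \<gamma> \<longleftrightarrow>
    0 < R \<and> \<gamma> piecewise_C1_differentiable_on {0..R} \<and> \<gamma> ` {0..R} \<subseteq> \<Omega> \<and>
    (\<forall>s t. 0 \<le> s \<and> s \<le> t \<and> t \<le> R \<longrightarrow>
      (\<forall>\<sigma>. valid_path \<sigma> \<and> path_image \<sigma> \<subseteq> \<Omega> \<and>
           pathstart \<sigma> = \<gamma> s \<and> pathfinish \<sigma> = \<gamma> t \<longrightarrow>
        hyperbolic_length \<Omega> \<gamma> s t \<le> hyperbolic_length \<Omega> \<sigma> 0 1))"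

(* Meaningful for simply connected domains other than the whole plane. *)
definition visible_domain :: "complex set \<Rightarrow> bool"
  where "visible_domain \<Omega> \<longleftrightarrow>
    (\<forall>p\<in>sphere_boundary \<Omega>. \<forall>q\<in>sphere_boundary \<Omega>. p \<noteq> q \<longrightarrow>
      (\<exists>K. compact K \<and> K \<subseteq> \<Omega> \<and>
        (\<forall>\<gamma> R. (\<forall>n. geodesic_segment \<Omega> (R n) (\<gamma> n)) \<and>
            (\<lambda>n. to_sphere (\<gamma> n 0)) \<longlonglongrightarrow> p \<and> (\<lambda>n. to_sphere (\<gamma> n (R n))) \<longlonglongrightarrow> q \<longrightarrow>
          (\<forall>\<^sub>F n in sequentially. \<gamma> n ` {0..R n} \<inter> K \<noteq> {}))))"

end

theory Submission
  imports Defs "HOL-Real_Asymp.Real_Asymp"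
begin

text \<open>If \<open>g\<close> maps the disc biholomorphically onto \<open>\<Omega>\<close>, a fixed point free self-map of \<open>\<Omega>\<close> becomes one
  of the disc, whose orbits converge to a boundary point \<open>x\<close> inside a horodisc at \<open>x\<close> (Wolff).  So the
  Denjoy-Wolff Property only needs limits of \<open>g\<close> along horodiscs, whereas two different
  unrestricted limits of \<open>g\<close> at one boundary point already destroy visibility.  Both happen for
  \<open>g z = - (\<Sum>k. t\<^sub>k / c\<^sub>k * Ln (1 - c\<^sub>k * z))\<close> with \<open>c\<^sub>k \<rightarrow> 1\<close>, \<open>Im c\<^sub>k = t\<^sub>k = 2 ^ - (k + 1)\<close> and
  \<open>1 - |c\<^sub>k|\<^sup>2 = exp (- B / t\<^sub>k)\<close>.  Its derivative has positive real part, so \<open>g\<close> is injective.  The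
  \<open>k\<close>-th logarithmic pole lies extremely close to the circle and gives a peak of height about \<open>B\<close> near
  the conjugate of \<open>c\<^sub>k\<close>; these points tend to \<open>1\<close> but leave every horodisc at \<open>1\<close>.\<close>

section \<open>The Denjoy-Wolff theorem on the disc\<close>

text \<open>At z = conjugate of c_k one has \<open>1 - centre k * z = depth k\<close>, so the k-th
  term has size about \<open>gap k * ln (1 / depth k)\<close>. The exponential form of
  \<open>depth k\<close> makes this product the same number \<open>peak\<close> for every k,
  although the weights \<open>gap k\<close> tend to 0. The same choice hides the peaks from
  horodiscs: the peak point lies at distance at least \<open>gap k\<close> from 1, while 1 - |z|^2 =
  \<open>depth k\<close> is exponentially small, so |1 - z|^2 / (1 - |z|^2) is unbounded along the
  peaks. Inside a fixed horodisc at 1, |1 - c_k z| is at least a constant times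
  \<open>(gap k)\<^sup>2\<close>; the k-th term is then of order k / 2^k and the series converges
  uniformly up to the point 1. The difficulty is to have this together with a bounded image. Halving
  the imaginary part of c_k at each step separates the peaks, so that at any point at most one term
  is large. All the others together stay below \<open>majorant_total\<close>, which also bounds the
  map on the radius towards 1, whereas the peaks rise strictly above it.\<close>

lemma one_minus_cnj_mult_nonzero:
  assumes "norm w < 1" "norm z < 1"
  shows "1 - cnj w * z \<noteq> 0"
  by (metis assms complex_mod_cnj less_irrefl mult.right_neutral norm_mult_less norm_one right_minus_eq)

lemma one_minus_norm_square_le:
  assumes "norm z \<le> 1"
  shows "1 - (norm z)\<^sup>2 \<le> 2 * (1 - norm z)"
proof -
  have "(1 - norm z) * (1 + norm z) \<le> (1 - norm z) * 2" using assms by (intro mult_left_mono) auto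
  then show ?thesis by (simp add: power2_eq_square algebra_simps)
qed

lemma one_minus_norm_Moebius_function:
  assumes "norm w < 1" "norm z < 1"
  shows "1 - (norm (Moebius_function 0 w z))\<^sup>2
    = (1 - (norm w)\<^sup>2) * (1 - (norm z)\<^sup>2) / (norm (1 - cnj w * z))\<^sup>2"
proof -
  have "1 - cnj w * z \<noteq> 0" using assms by (rule one_minus_cnj_mult_nonzero)
  then show ?thesis
    apply (cases w, cases z)
    apply (simp add: Moebius_function_def divide_simps norm_divide norm_mult)
    apply (simp add: complex_norm complex_diff complex_mult one_complex.code complex_cnj)
    apply (auto simp: algebra_simps power2_eq_square)
    done
qed

lemma one_minus_norm_square_pos: "norm z < 1 \<Longrightarrow> 0 < 1 - (norm z)\<^sup>2"
  by (simp add: abs_square_less_1)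

text \<open>The value is \<open>cosh\<^sup>2 (d / 2)\<close> for the Poincare distance \<open>d\<close>; it turns statements about
  distances into rational identities.\<close>
definition cosh_half_dist_sq :: "complex \<Rightarrow> complex \<Rightarrow> real" where
  "cosh_half_dist_sq z w = (norm (1 - cnj w * z))\<^sup>2 / ((1 - (norm z)\<^sup>2) * (1 - (norm w)\<^sup>2))"

text \<open>Composing with disc automorphisms moves both \<open>w\<close> and its image to 0, where
  the Schwarz lemma applies. Its two conclusions give the distance form and the derivative form of
  Schwarz-Pick.\<close>

lemma Schwarz_Pick_aux:
  assumes hol: "\<phi> holomorphic_on ball 0 1" and maps: "\<phi> ` ball 0 1 \<subseteq> ball 0 1" and w: "norm w < 1"
  defines "F \<equiv> Moebius_function 0 (\<phi> w) \<circ> (\<phi> \<circ> Moebius_function 0 (-w))"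
  shows "F holomorphic_on ball 0 1" "F 0 = 0" "\<And>z. norm z < 1 \<Longrightarrow> norm (F z) < 1"
proof -
  have \<phi>w: "norm (\<phi> w) < 1" using maps w by (auto simp: image_subset_iff)
  have M: "Moebius_function 0 (-w) ` ball 0 1 \<subseteq> ball 0 1"
    using w by (auto intro!: Moebius_function_norm_lt_1)
  show "F holomorphic_on ball 0 1"
    unfolding F_def
  proof (rule holomorphic_on_compose_gen)
    show "\<phi> \<circ> Moebius_function 0 (-w) holomorphic_on ball 0 1"
      by (rule holomorphic_on_compose_gen[OF _ hol M]) (use w in \<open>auto intro!: Moebius_function_holomorphic\<close>)
    show "Moebius_function 0 (\<phi> w) holomorphic_on ball 0 1"
      using \<phi>w by (intro Moebius_function_holomorphic)
    show "(\<phi> \<circ> Moebius_function 0 (-w)) ` ball 0 1 \<subseteq> ball 0 1"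
      using M maps by (auto simp: image_subset_iff)
  qed
  show "F 0 = 0" by (simp add: F_def Moebius_function_def)
  show "norm (F z) < 1" if "norm z < 1" for z
    unfolding F_def comp_def
  proof (rule Moebius_function_norm_lt_1[OF \<phi>w])
    have "Moebius_function 0 (-w) z \<in> ball 0 1" using that M by (auto simp: image_subset_iff)
    then show "norm (\<phi> (Moebius_function 0 (-w) z)) < 1" using maps by (auto simp: image_subset_iff)
  qed
qed

lemma Schwarz_Pick:
  assumes hol: "\<phi> holomorphic_on ball 0 1" and maps: "\<phi> ` ball 0 1 \<subseteq> ball 0 1"
    and w: "norm w < 1" and z: "norm z < 1"
  shows "cosh_half_dist_sq (\<phi> z) (\<phi> w) \<le> cosh_half_dist_sq z w"
proof -
  have \<phi>w: "norm (\<phi> w) < 1" and \<phi>z: "norm (\<phi> z) < 1" using maps w z by (auto simp: image_subset_iff)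
  note A = Schwarz_Pick_aux[OF hol maps w]
  have "norm (Moebius_function 0 w z) < 1"
    using w z by (rule Moebius_function_norm_lt_1)
  from Schwarz_Lemma(1)[OF A this]
  have "norm (Moebius_function 0 (\<phi> w) (\<phi> z)) \<le> norm (Moebius_function 0 w z)"
    using Moebius_function_compose[of "-w" w z] w z by simp
  then have "1 - (norm (Moebius_function 0 w z))\<^sup>2 \<le> 1 - (norm (Moebius_function 0 (\<phi> w) (\<phi> z)))\<^sup>2"
    by (simp add: power_mono)
  then have *: "(1 - (norm w)\<^sup>2) * (1 - (norm z)\<^sup>2) / (norm (1 - cnj w * z))\<^sup>2
      \<le> (1 - (norm (\<phi> w))\<^sup>2) * (1 - (norm (\<phi> z))\<^sup>2) / (norm (1 - cnj (\<phi> w) * \<phi> z))\<^sup>2"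
    by (simp only: one_minus_norm_Moebius_function[OF w z] one_minus_norm_Moebius_function[OF \<phi>w \<phi>z])
  have "0 < (1 - (norm w)\<^sup>2) * (1 - (norm z)\<^sup>2) / (norm (1 - cnj w * z))\<^sup>2"
    using one_minus_cnj_mult_nonzero[OF w z] one_minus_norm_square_pos[OF w] one_minus_norm_square_pos[OF z]
    by simp
  from le_imp_inverse_le[OF * this] show ?thesis
    by (simp add: cosh_half_dist_sq_def mult.commute)
qed

lemma Moebius_function_DERIV:
  assumes "1 - cnj w * z \<noteq> 0"
  shows "(Moebius_function 0 w has_field_derivative (1 - cnj w * w) / (1 - cnj w * z)\<^sup>2) (at z)"
  unfolding Moebius_function_def
  using assms by (auto intro!: derivative_eq_intros simp: power2_eq_square field_simps)

text \<open>The infinitesimal form; it makes the density of the Poincare metric independent of the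
  Riemann map.\<close>

lemma Schwarz_Pick_deriv:
  assumes hol: "\<phi> holomorphic_on ball 0 1" and maps: "\<phi> ` ball 0 1 \<subseteq> ball 0 1" and w: "norm w < 1"
  shows "norm (deriv \<phi> w) / (1 - (norm (\<phi> w))\<^sup>2) \<le> 1 / (1 - (norm w)\<^sup>2)"
proof -
  have \<phi>w: "norm (\<phi> w) < 1" using maps w by (auto simp: image_subset_iff)
  note A = Schwarz_Pick_aux[OF hol maps w]
  have 1: "(Moebius_function 0 (-w) has_field_derivative (1 - cnj w * w)) (at 0)"
    using Moebius_function_DERIV[of "-w" 0] by simp
  have [simp]: "Moebius_function 0 (-w) 0 = w" by (simp add: Moebius_function_def)
  have "(\<phi> has_field_derivative deriv \<phi> w) (at w)"
    using hol w by (intro holomorphic_derivI[of _ "ball 0 1"]) auto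
  then have 2: "(\<phi> \<circ> Moebius_function 0 (-w) has_field_derivative deriv \<phi> w * (1 - cnj w * w)) (at 0)"
    using 1 by (intro DERIV_chain) auto
  have nz: "1 - cnj (\<phi> w) * \<phi> w \<noteq> 0" using one_minus_cnj_mult_nonzero[OF \<phi>w \<phi>w] .
  have 3: "(Moebius_function 0 (\<phi> w) has_field_derivative 1 / (1 - cnj (\<phi> w) * \<phi> w)) (at (\<phi> w))"
    using Moebius_function_DERIV[OF nz] nz by (simp add: power2_eq_square)
  have "(Moebius_function 0 (\<phi> w) \<circ> (\<phi> \<circ> Moebius_function 0 (-w)) has_field_derivative
      1 / (1 - cnj (\<phi> w) * \<phi> w) * (deriv \<phi> w * (1 - cnj w * w))) (at 0)"
    by (rule DERIV_chain[OF _ 2]) (simp add: 3)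
  from DERIV_imp_deriv[OF this] Schwarz_Lemma(2)[OF A, of 0]
  have "norm (1 / (1 - cnj (\<phi> w) * \<phi> w) * (deriv \<phi> w * (1 - cnj w * w))) \<le> 1"
    by (simp add: comp_def)
  moreover have c: "1 - cnj u * u = of_real (1 - (norm u)\<^sup>2)" for u
    by (metis complex_norm_square mult.commute of_real_1 of_real_diff of_real_power)
  ultimately show ?thesis
    unfolding c
    using one_minus_norm_square_pos[OF w] one_minus_norm_square_pos[OF \<phi>w]
    by (simp add: norm_mult norm_divide field_simps del: of_real_diff)
qed

section \<open>Horodiscs and the Wolff point\<close>

text \<open>For |x| = 1 and R > 0 this is the closed Euclidean disc with centre x / (1 + R) and
  radius R / (1 + R), tangent to the unit circle at \<open>x\<close>; the point \<open>x\<close>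
  itself belongs to it.\<close>

definition horodisc :: "complex \<Rightarrow> real \<Rightarrow> complex set" where
  "horodisc x R = {z. (norm (x - z))\<^sup>2 \<le> R * (1 - (norm z)\<^sup>2)}"

lemma norm_one_minus_cnj_mult:
  assumes "norm x = 1"
  shows "norm (1 - cnj x * z) = norm (x - z)"
proof -
  have "x * (1 - cnj x * z) = x - z"
    using assms complex_norm_square[of x] by (simp add: algebra_simps)
  then show ?thesis
    by (metis assms mult_1 norm_mult)
qed

text \<open>\<open>x\<close> is a limit of fixed points of the contracted maps
  \<open>r k * \<phi>\<close>. Schwarz-Pick with respect to these fixed points controls discs around
  them, and the discs become horodiscs in the limit.\<close>

lemma Wolff_lemma:
  assumes hol: "\<phi> holomorphic_on ball 0 1" and maps: "\<phi> ` ball 0 1 \<subseteq> ball 0 1"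
    and nofix: "\<And>z. norm z < 1 \<Longrightarrow> \<phi> z \<noteq> z"
  obtains x where "norm x = 1"
    "\<And>z. norm z < 1 \<Longrightarrow>
       (norm (x - \<phi> z))\<^sup>2 / (1 - (norm (\<phi> z))\<^sup>2) \<le> (norm (x - z))\<^sup>2 / (1 - (norm z)\<^sup>2)"
proof -
  define r :: "nat \<Rightarrow> real" where "r k = 1 - 1 / (real k + 2)" for k
  have r: "0 < r k" "r k < 1" for k by (auto simp: r_def field_simps)
  have r_lim: "r \<longlonglongrightarrow> 1" unfolding r_def by real_asymp
  have rb: "of_real (r k) * z \<in> ball 0 1" if "z \<in> cball 0 1" for k and z :: complex
  proof -
    have "r k * norm z \<le> r k * 1" using that r[of k] by (intro mult_left_mono) auto
    then have "r k * norm z < 1" using r[of k] by linarith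
    then show ?thesis using r[of k] by (simp add: norm_mult)
  qed
  \<comment> \<open>Such a \<open>v\<close> is a fixed point of \<open>r k * \<phi>\<close>. Brouwer
    is applied to \<open>\<phi> (r k * z)\<close> instead, which is defined on the whole closed
    disc, and its fixed point is then multiplied by \<open>r k\<close>.\<close>
  have "\<exists>v. norm v < 1 \<and> \<phi> v = v / of_real (r k)" for k
  proof -
    have "continuous_on (cball 0 1) (\<lambda>z. \<phi> (of_real (r k) * z))"
      by (intro continuous_on_compose2[OF holomorphic_on_imp_continuous_on[OF hol]] continuous_intros)
         (use rb in auto)
    moreover have "(\<lambda>z. \<phi> (of_real (r k) * z)) \<in> cball 0 1 \<rightarrow> cball 0 1"
    proof
      fix z :: complex assume "z \<in> cball 0 1"
      then have "\<phi> (of_real (r k) * z) \<in> ball 0 1" using rb maps by (auto simp: image_subset_iff)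
      then show "\<phi> (of_real (r k) * z) \<in> cball 0 1" by simp
    qed
    ultimately obtain w where w: "w \<in> cball 0 1" "\<phi> (of_real (r k) * w) = w"
      using brouwer[of "cball (0::complex) 1" "\<lambda>z. \<phi> (of_real (r k) * z)"] by auto
    then show ?thesis using rb[OF w(1)] r[of k]
      by (intro exI[of _ "of_real (r k) * w"]) auto
  qed
  then obtain v where v: "\<And>k. norm (v k) < 1" "\<And>k. \<phi> (v k) = v k / of_real (r k)"
    by metis
  have "\<forall>k. v k \<in> cball 0 1" using v(1) by (simp add: less_imp_le)
  then obtain x s where x: "x \<in> cball 0 1" "strict_mono s" "(v \<circ> s) \<longlonglongrightarrow> x"
    using compact_cball[of "0::complex" 1] unfolding compact_def by metis
  have rs: "(\<lambda>k. complex_of_real (r (s k))) \<longlonglongrightarrow> of_real 1"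
    using LIMSEQ_subseq_LIMSEQ[OF r_lim x(2)] by (intro tendsto_of_real) (simp add: comp_def)
  have vs: "(\<lambda>k. v (s k)) \<longlonglongrightarrow> x" using x(3) by (simp add: comp_def)
  have \<phi>v: "(\<lambda>k. \<phi> (v (s k))) \<longlonglongrightarrow> x"
    using tendsto_divide[OF vs rs] by (simp add: v(2))
  \<comment> \<open>An interior limit would be a fixed point of \<open>\<phi>\<close> by
    continuity.\<close>
  have "norm x = 1"
  proof (rule ccontr)
    assume "norm x \<noteq> 1"
    then have nx: "norm x < 1" using x(1) by auto
    then have "isCont \<phi> x"
      using holomorphic_on_imp_continuous_on[OF hol] by (simp add: continuous_on_eq_continuous_at)
    then have "(\<lambda>k. \<phi> (v (s k))) \<longlonglongrightarrow> \<phi> x" using vs by (rule isCont_tendsto_compose)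
    with \<phi>v have "\<phi> x = x" using LIMSEQ_unique by blast
    then show False using nofix nx by blast
  qed
  moreover have "(norm (x - \<phi> z))\<^sup>2 / (1 - (norm (\<phi> z))\<^sup>2) \<le> (norm (x - z))\<^sup>2 / (1 - (norm z)\<^sup>2)"
    if z: "norm z < 1" for z
  proof -
    have \<phi>z: "norm (\<phi> z) < 1" using maps z by (auto simp: image_subset_iff)
    have "(norm (1 - cnj (\<phi> (v k)) * \<phi> z))\<^sup>2 / (1 - (norm (\<phi> z))\<^sup>2)
       \<le> (norm (1 - cnj (v k) * z))\<^sup>2 / (1 - (norm z)\<^sup>2)" for k
    proof -
      have \<phi>vk: "norm (\<phi> (v k)) < 1" using maps v(1) by (auto simp: image_subset_iff)
      \<comment> \<open>Division by \<open>r k\<close> < 1 pushes the image outwards. So the factors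
        1 - |v|^2 and 1 - |\<phi> v|^2, which degenerate in the limit, can be cancelled from the
        Schwarz-Pick inequality in the right direction.\<close>
      have "norm (v k) \<le> norm (\<phi> (v k))"
        using r[of k] by (simp add: v(2) norm_divide field_simps mult_left_le_one_le mult_right_le_one_le)
      then have le: "1 - (norm (\<phi> (v k)))\<^sup>2 \<le> 1 - (norm (v k))\<^sup>2"
        by (simp add: power_mono)
      have "cosh_half_dist_sq (\<phi> z) (\<phi> (v k)) \<le> cosh_half_dist_sq z (v k)"
        by (rule Schwarz_Pick[OF hol maps v(1) z])
      then have "cosh_half_dist_sq (\<phi> z) (\<phi> (v k)) * (1 - (norm (\<phi> (v k)))\<^sup>2)
          \<le> cosh_half_dist_sq z (v k) * (1 - (norm (v k))\<^sup>2)"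
        using le one_minus_norm_square_pos[OF z] one_minus_norm_square_pos[OF v(1)[of k]]
          one_minus_norm_square_pos[OF \<phi>vk]
        by (intro mult_mono) (auto simp: cosh_half_dist_sq_def)
      then show ?thesis
        using one_minus_norm_square_pos[OF v(1)[of k]] one_minus_norm_square_pos[OF \<phi>vk]
        by (simp add: cosh_half_dist_sq_def)
    qed
    moreover have "(\<lambda>k. (norm (1 - cnj (\<phi> (v (s k))) * \<phi> z))\<^sup>2 / (1 - (norm (\<phi> z))\<^sup>2)) \<longlonglongrightarrow>
        (norm (1 - cnj x * \<phi> z))\<^sup>2 / (1 - (norm (\<phi> z))\<^sup>2)"
      using one_minus_norm_square_pos[OF \<phi>z] \<phi>v by (intro tendsto_intros) auto
    moreover have "(\<lambda>k. (norm (1 - cnj (v (s k)) * z))\<^sup>2 / (1 - (norm z)\<^sup>2)) \<longlonglongrightarrow>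
        (norm (1 - cnj x * z))\<^sup>2 / (1 - (norm z)\<^sup>2)"
      using one_minus_norm_square_pos[OF z] vs by (intro tendsto_intros) auto
    ultimately have "(norm (1 - cnj x * \<phi> z))\<^sup>2 / (1 - (norm (\<phi> z))\<^sup>2)
        \<le> (norm (1 - cnj x * z))\<^sup>2 / (1 - (norm z)\<^sup>2)"
      by (intro LIMSEQ_le) auto
    then show ?thesis using \<open>norm x = 1\<close> by (simp add: norm_one_minus_cnj_mult)
  qed
  ultimately show thesis using that by blast
qed

lemma holomorphic_on_funpow_ball:
  assumes hol: "\<phi> holomorphic_on S" and maps: "\<phi> ` S \<subseteq> S"
  shows "(\<phi> ^^ n) holomorphic_on S \<and> (\<phi> ^^ n) ` S \<subseteq> S"
proof (induction n)
  case (Suc n)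
  then have "(\<phi> \<circ> (\<phi> ^^ n)) holomorphic_on S"
    using hol by (intro holomorphic_on_compose_gen) auto
  then show ?case using Suc maps by (auto simp: image_subset_iff comp_def)
qed (auto simp: id_def)

text \<open>The right side is the Poisson kernel at \<open>x\<close>: horodiscs at \<open>x\<close>
  become half-planes, and Wolff's inequality says that the real part does not decrease.\<close>

lemma Re_Cayley:
  assumes "norm x = 1"
  shows "Re ((x + z) / (x - z)) = (1 - (norm z)\<^sup>2) / (norm (x - z))\<^sup>2"
proof -
  have "(Re x)\<^sup>2 + (Im x)\<^sup>2 = 1" using assms by (simp add: cmod_def)
  then show ?thesis
    by (simp add: Re_divide cmod_power2) (simp add: power2_eq_square algebra_simps)
qed

text \<open>In the right half-plane, where \<open>x\<close> becomes \<open>\<infinity>\<close>, the map is \<open>w \<mapsto> w + P\<close> with \<open>Re P \<ge> 0\<close> by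
  Wolff's lemma.  Either \<open>P\<close> is a non-zero constant, or \<open>Re P > 0\<close> and \<open>Re w\<close> increases strictly,
  which excludes an accumulation point inside.\<close>
lemma orbit_norm_tendsto_1:
  assumes hol: "\<phi> holomorphic_on ball 0 1" and maps: "\<phi> ` ball 0 1 \<subseteq> ball 0 1"
    and nofix: "\<And>z. norm z < 1 \<Longrightarrow> \<phi> z \<noteq> z" and x: "norm x = 1"
    and wolff: "\<And>z. norm z < 1 \<Longrightarrow>
       (norm (x - \<phi> z))\<^sup>2 / (1 - (norm (\<phi> z))\<^sup>2) \<le> (norm (x - z))\<^sup>2 / (1 - (norm z)\<^sup>2)"
  shows "(\<lambda>n. norm ((\<phi> ^^ n) 0)) \<longlonglongrightarrow> 1"
proof -
  define u where "u n = (\<phi> ^^ n) 0" for n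
  have u_Suc: "u (Suc n) = \<phi> (u n)" and u_0: "u 0 = 0" for n by (auto simp: u_def)
  have u: "norm (u n) < 1" for n
    using holomorphic_on_funpow_ball[OF hol maps, of n] by (auto simp: u_def image_subset_iff)
  define C where "C z = (x + z) / (x - z)" for z
  define P where "P z = C (\<phi> z) - C z" for z
  have \<phi>: "norm (\<phi> z) < 1" if "norm z < 1" for z
    using that maps by (auto simp: image_subset_iff)
  have xz: "x - z \<noteq> 0" if "norm z < 1" for z using that x by auto
  have C_hol: "C holomorphic_on ball 0 1"
    unfolding C_def using xz by (intro holomorphic_intros) auto
  have "(C \<circ> \<phi>) holomorphic_on ball 0 1"
    by (rule holomorphic_on_compose_gen[OF hol C_hol maps])
  then have P_hol: "P holomorphic_on ball 0 1"
    unfolding P_def using C_hol by (intro holomorphic_intros) (auto simp: comp_def)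
  have P_nonneg: "0 \<le> Re (P z)" if z: "norm z < 1" for z
  proof -
    have "0 < (norm (x - \<phi> z))\<^sup>2 / (1 - (norm (\<phi> z))\<^sup>2)"
      using one_minus_norm_square_pos[OF \<phi>[OF z]] xz[OF \<phi>[OF z]] by auto
    from le_imp_inverse_le[OF wolff[OF z] this] show ?thesis
      by (simp add: P_def C_def Re_Cayley[OF x])
  qed
  have C_plus_1: "C z + 1 = 2 * x / (x - z)" if "norm z < 1" for z
    using xz[OF that] by (simp add: C_def field_simps)
  have "(\<lambda>n. norm (u n)) \<longlonglongrightarrow> 1"
  proof (cases "\<exists>y\<in>ball 0 1. Re (P y) = 0")
    case True
    then obtain y where y: "y \<in> ball 0 1" "Re (P y) = 0" by blast
    \<comment> \<open>Otherwise the image of \<open>P\<close> would be open around a point of the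
      imaginary axis and would contain points with negative real part.\<close>
    have "P constant_on ball 0 1"
    proof (rule ccontr)
      assume "\<not> P constant_on ball 0 1"
      then have "open (P ` ball 0 1)"
        using open_mapping_thm[OF P_hol, of "ball 0 1"] by auto
      then obtain e where e: "e > 0" "ball (P y) e \<subseteq> P ` ball 0 1"
        using y(1) unfolding open_contains_ball by blast
      have "P y - of_real (e / 2) \<in> ball (P y) e" using e(1) by (simp add: dist_norm)
      then obtain z where "z \<in> ball 0 1" "P y - of_real (e / 2) = P z" using e(2) by blast
      then have "Re (P y - of_real (e / 2)) \<ge> 0" using P_nonneg[of z] by simp
      then show False using y(2) e(1) by simp
    qed
    then obtain p where p: "\<And>z. norm z < 1 \<Longrightarrow> P z = p" unfolding constant_on_def by auto
    have "p \<noteq> 0"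
    proof
      assume "p = 0"
      then have "C (\<phi> 0) + 1 = C 0 + 1" using p[of 0] by (simp add: P_def)
      then have "2 * x / (x - \<phi> 0) = 2" using C_plus_1[of "\<phi> 0"] C_plus_1[of 0] \<phi>[of 0] x by force
      then have "\<phi> 0 = 0" using xz[OF \<phi>[of 0]] by (auto simp: field_simps)
      then show False using nofix[of 0] by simp
    qed
    have Cu: "C (u n) = 1 + of_nat n * p" for n
    proof (induction n)
      case 0 then show ?case using x by (auto simp: u_0 C_def)
    next
      case (Suc n)
      have "C (u (Suc n)) = C (u n) + p" using p[OF u[of n]] by (simp add: P_def u_Suc algebra_simps)
      then show ?case using Suc by (simp add: algebra_simps)
    qed
    have "norm (x - u n) \<le> 2 / (real n * norm p - 2)" if n: "real n * norm p > 2" for n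
    proof -
      have "(2 + of_nat n * p) * (x - u n) = 2 * x"
        using C_plus_1[OF u[of n]] xz[OF u[of n]] by (simp add: Cu field_simps)
      then have "norm ((2 + of_nat n * p) * (x - u n)) = 2" by (simp only: norm_mult x) simp
      then have "norm (2 + of_nat n * p) * norm (x - u n) = 2" by (simp only: norm_mult)
      moreover
      have "real n * norm p - 2 \<le> norm (2 + of_nat n * p)"
        using norm_triangle_ineq2[of "of_nat n * p" "-2"] by (simp add: norm_mult add.commute)
      then have "(real n * norm p - 2) * norm (x - u n) \<le> norm (2 + of_nat n * p) * norm (x - u n)"
        by (intro mult_right_mono) auto
      ultimately show ?thesis using n by (simp add: field_simps)
    qed
    moreover have "\<forall>\<^sub>F n in sequentially. real n * norm p > 2" and lim: "(\<lambda>n. 2 / (real n * norm p - 2)) \<longlonglongrightarrow> 0"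
      using \<open>p \<noteq> 0\<close> by real_asymp+
    ultimately have "\<forall>\<^sub>F n in sequentially. norm (x - u n) \<le> 2 / (real n * norm p - 2)"
      by (auto elim: eventually_mono)
    from Lim_null_comparison[OF this lim] have "(\<lambda>n. x - u n) \<longlonglongrightarrow> 0" .
    from tendsto_diff[OF tendsto_const[of x] this] have "u \<longlonglongrightarrow> x" by simp
    from tendsto_norm[OF this] show ?thesis by (simp add: x)
  next
    case False
    then have P_pos: "0 < Re (P z)" if "norm z < 1" for z
      using P_nonneg[OF that] that by (force simp: less_le)
    show ?thesis
    proof (rule ccontr)
      assume "\<not> (\<lambda>n. norm (u n)) \<longlonglongrightarrow> 1"
      then obtain e where e: "e > 0" "\<exists>\<^sub>F n in sequentially. \<not> dist (norm (u n)) 1 < e"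
        unfolding tendsto_iff not_eventually[symmetric] by blast
      have "norm (u n) \<le> 1 - e" if "\<not> dist (norm (u n)) 1 < e" for n
        using u[of n] that by (simp add: dist_real_def)
      with e(2) have "\<exists>\<^sub>F n in sequentially. u n \<in> cball 0 (1 - e)"
        by (auto elim: frequently_elim1)
      then obtain s0 :: "nat \<Rightarrow> nat" where s0: "strict_mono s0" "\<And>n. u (s0 n) \<in> cball 0 (1 - e)"
        using infinite_enumerate[of "{n. u n \<in> cball 0 (1 - e)}"]
        unfolding cofinite_eq_sequentially[symmetric] frequently_cofinite by auto
      then obtain y s1 where s1: "y \<in> cball 0 (1 - e)" "strict_mono s1" "((u \<circ> s0) \<circ> s1) \<longlonglongrightarrow> y"
        using compact_cball[of "0::complex" "1 - e"] unfolding compact_def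
        by (metis comp_apply)
      define s where "s = s0 \<circ> s1"
      have s: "strict_mono s" using s0 s1 by (simp add: s_def strict_mono_o)
      have us: "(\<lambda>n. u (s n)) \<longlonglongrightarrow> y" using s1(3) by (simp add: s_def comp_def)
      have y: "norm y < 1" using s1(1) e(1) by simp
      have cont: "isCont (\<lambda>z. Re (C z)) y" "isCont (\<lambda>z. Re (C (\<phi> z))) y"
        using y holomorphic_on_imp_continuous_on[OF C_hol]
          holomorphic_on_imp_continuous_on[OF \<open>(C \<circ> \<phi>) holomorphic_on ball 0 1\<close>]
        by (auto simp: continuous_on_eq_continuous_at comp_def)
      \<comment> \<open>Since \<open>Suc (s n) \<le> s (Suc n)\<close>, monotonicity compares the
        image of one term of the subsequence with the next term. In the limit this contradicts the
        strict increase at \<open>y\<close>.\<close>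
      have "incseq (\<lambda>n. Re (C (u n)))"
        using P_nonneg[OF u] by (intro incseq_SucI) (simp add: P_def u_Suc)
      then have "Re (C (u (Suc (s n)))) \<le> Re (C (u (s (Suc n))))" for n
        by (rule incseqD) (use s in \<open>simp add: Suc_leI strict_monoD\<close>)
      then have "Re (C (\<phi> (u (s n)))) \<le> Re (C (u (s (Suc n))))" for n by (simp add: u_Suc)
      moreover have "(\<lambda>n. Re (C (\<phi> (u (s n))))) \<longlonglongrightarrow> Re (C (\<phi> y))"
        by (rule isCont_tendsto_compose[OF cont(2) us])
      moreover have "(\<lambda>n. Re (C (u (s (Suc n))))) \<longlonglongrightarrow> Re (C y)"
        by (rule isCont_tendsto_compose[OF cont(1)]) (rule LIMSEQ_Suc[OF us])
      ultimately have "Re (C (\<phi> y)) \<le> Re (C y)" by (intro LIMSEQ_le) auto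
      then show False using P_pos[OF y] by (simp add: P_def)
    qed
  qed
  then show ?thesis by (simp add: u_def)
qed

lemma compact_subset_ball_imp_subset_cball:
  assumes "compact K" "K \<subseteq> ball (0::'a::real_normed_vector) 1"
  obtains r where "0 \<le> r" "r < 1" "K \<subseteq> cball 0 r"
proof (cases "K = {}")
  case True then show thesis using that[of 0] by simp
next
  case False
  then obtain y where "y \<in> K" "\<forall>z\<in>K. norm z \<le> norm y"
    using continuous_attains_sup[OF assms(1), of norm] by (auto intro: continuous_intros)
  then show thesis using assms(2) by (intro that[of "norm y"]) auto
qed

text \<open>Everything is reduced to the orbit of 0. Orbits starting in a compact set keep a bounded
  hyperbolic distance from it, so they approach the circle with it, and inside a horodisc 1 - |w|^2
  controls the distance from \<open>x\<close>.\<close>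

theorem Denjoy_Wolff:
  assumes hol: "\<phi> holomorphic_on ball 0 1" and maps: "\<phi> ` ball 0 1 \<subseteq> ball 0 1"
    and nofix: "\<And>z. norm z < 1 \<Longrightarrow> \<phi> z \<noteq> z"
  obtains x where "norm x = 1"
    "\<And>K. compact K \<Longrightarrow> K \<subseteq> ball 0 1 \<Longrightarrow> \<exists>R. \<forall>n. \<forall>z\<in>K. (\<phi> ^^ n) z \<in> horodisc x R"
    "\<And>K. compact K \<Longrightarrow> K \<subseteq> ball 0 1 \<Longrightarrow> uniform_limit K (\<lambda>n. \<phi> ^^ n) (\<lambda>_. x) sequentially"
proof -
  obtain x where x: "norm x = 1"
    and wolff: "\<And>z. norm z < 1 \<Longrightarrow>
       (norm (x - \<phi> z))\<^sup>2 / (1 - (norm (\<phi> z))\<^sup>2) \<le> (norm (x - z))\<^sup>2 / (1 - (norm z)\<^sup>2)"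
    using Wolff_lemma[OF hol maps nofix] by blast
  note lim = orbit_norm_tendsto_1[OF hol maps nofix x wolff]
  have iter: "norm ((\<phi> ^^ n) z) < 1" if "norm z < 1" for n z
    using holomorphic_on_funpow_ball[OF hol maps, of n] that by (auto simp: image_subset_iff)
  have horo: "(norm (x - (\<phi> ^^ n) z))\<^sup>2 \<le> 4 / (1 - r\<^sup>2) * (1 - (norm ((\<phi> ^^ n) z))\<^sup>2)"
    if z: "norm z \<le> r" and r: "0 \<le> r" "r < 1" for n z r
  proof -
    have z1: "norm z < 1" using z r by simp
    have "(norm (x - (\<phi> ^^ n) z))\<^sup>2 / (1 - (norm ((\<phi> ^^ n) z))\<^sup>2) \<le> (norm (x - z))\<^sup>2 / (1 - (norm z)\<^sup>2)"
    proof (induction n)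
      case (Suc n)
      show ?case using wolff[OF iter[OF z1, of n]] Suc by simp
    qed simp
    also have "\<dots> \<le> 2\<^sup>2 / (1 - r\<^sup>2)"
    proof (intro frac_le power_mono)
      show "norm (x - z) \<le> 2" using norm_triangle_ineq4[of x z] x z1 by simp
      show "0 < 1 - r\<^sup>2" using r by (simp add: abs_square_less_1)
      show "1 - r\<^sup>2 \<le> 1 - (norm z)\<^sup>2" using z by (simp add: power_mono)
    qed auto
    finally show ?thesis
      using one_minus_norm_square_pos[OF iter[OF z1, of n]] by (simp add: field_simps)
  qed
  show thesis
  proof (rule that[OF x])
    fix K :: "complex set" assume K: "compact K" "K \<subseteq> ball 0 1"
    then obtain r where r: "0 \<le> r" "r < 1" "K \<subseteq> cball 0 r"
      by (rule compact_subset_ball_imp_subset_cball)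
    show "\<exists>R. \<forall>n. \<forall>z\<in>K. (\<phi> ^^ n) z \<in> horodisc x R"
      using horo[OF _ r(1,2)] r(3) by (intro exI[of _ "4 / (1 - r\<^sup>2)"]) (auto simp: horodisc_def)
    define M where "M = 1 / (1 - r\<^sup>2)"
    have r2: "0 < 1 - r\<^sup>2" using r by (simp add: abs_square_less_1)
    then have M: "M > 0" by (simp add: M_def)
    \<comment> \<open>\<open>M\<close> bounds \<open>cosh_half_dist_sq z 0\<close> on
      \<open>K\<close>. Hence 1 - |w| is at most 2 M (1 - |u|^2), and the horodisc bound 4 M (1 -
      |w|^2) then yields 4 M * 2 * 2 M = 16 M^2.\<close>
    define b where "b n = 16 * M\<^sup>2 * (1 - (norm ((\<phi> ^^ n) 0))\<^sup>2)" for n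
    have "(\<lambda>n. sqrt (b n)) \<longlonglongrightarrow> sqrt (16 * M\<^sup>2 * (1 - 1\<^sup>2))"
      unfolding b_def by (intro tendsto_intros lim)
    then have b_lim: "(\<lambda>n. sqrt (b n)) \<longlonglongrightarrow> 0" by simp
    have le: "dist ((\<phi> ^^ n) z) x \<le> sqrt (b n)" if "z \<in> K" for n z
    proof -
      have z: "norm z \<le> r" "norm z < 1" using that r K(2) by auto
      let ?w = "(\<phi> ^^ n) z" and ?u = "(\<phi> ^^ n) 0"
      have w: "norm ?w < 1" and u: "norm ?u < 1" using iter z by auto
      have "cosh_half_dist_sq ?w ?u \<le> cosh_half_dist_sq z 0"
        using holomorphic_on_funpow_ball[OF hol maps, of n] z by (intro Schwarz_Pick) auto
      also have "\<dots> \<le> M"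
        unfolding M_def cosh_half_dist_sq_def using z r2 by (auto intro!: divide_left_mono power_mono mult_pos_pos simp: abs_square_less_1)
      finally have 1: "(norm (1 - cnj ?u * ?w))\<^sup>2 \<le> M * ((1 - (norm ?w)\<^sup>2) * (1 - (norm ?u)\<^sup>2))"
        using one_minus_norm_square_pos[OF w] one_minus_norm_square_pos[OF u]
        by (simp add: cosh_half_dist_sq_def pos_divide_le_eq)
      \<comment> \<open>This bounds the square of 1 - |w| by a multiple of 1 - |w|; one factor is
        then cancelled.\<close>
      have "1 - norm ?w \<le> 1 - norm ?u * norm ?w"
        using u by (simp add: mult_left_le_one_le)
      also have "\<dots> \<le> norm (1 - cnj ?u * ?w)"
        using norm_triangle_ineq2[of 1 "cnj ?u * ?w"] by (simp add: norm_mult)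
      finally have "(1 - norm ?w)\<^sup>2 \<le> (norm (1 - cnj ?u * ?w))\<^sup>2"
        using w by (intro power_mono) auto
      also note 1
      also have "M * ((1 - (norm ?w)\<^sup>2) * (1 - (norm ?u)\<^sup>2)) \<le> M * ((2 * (1 - norm ?w)) * (1 - (norm ?u)\<^sup>2))"
        by (intro mult_left_mono mult_right_mono one_minus_norm_square_le) (use w M one_minus_norm_square_pos[OF u] in auto)
      finally have "(1 - norm ?w) * (1 - norm ?w) \<le> (1 - norm ?w) * (2 * M * (1 - (norm ?u)\<^sup>2))"
        by (simp add: power2_eq_square algebra_simps)
      then have 2: "1 - norm ?w \<le> 2 * M * (1 - (norm ?u)\<^sup>2)"
        using w by simp
      have "(norm (x - ?w))\<^sup>2 \<le> 4 * M * (1 - (norm ?w)\<^sup>2)"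
        using horo[OF z(1) r(1,2), of n] by (simp add: M_def)
      also have "\<dots> \<le> 4 * M * (2 * (1 - norm ?w))"
        by (intro mult_left_mono one_minus_norm_square_le) (use w M in auto)
      also have "\<dots> \<le> 4 * M * (2 * (2 * M * (1 - (norm ?u)\<^sup>2)))"
        using M 2 by (intro mult_left_mono) auto
      also have "\<dots> = b n" by (simp add: b_def power2_eq_square)
      finally show ?thesis by (simp add: dist_norm norm_minus_commute real_le_rsqrt)
    qed
    show "uniform_limit K (\<lambda>n. \<phi> ^^ n) (\<lambda>_. x) sequentially"
    proof (rule uniform_limitI)
      fix e :: real assume "e > 0"
      then have "\<forall>\<^sub>F n in sequentially. sqrt (b n) < e"
        using b_lim by (auto dest: order_tendstoD)
      then show "\<forall>\<^sub>F n in sequentially. \<forall>z\<in>K. dist ((\<phi> ^^ n) z) x < e"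
        by eventually_elim (meson le le_less_trans)
    qed
  qed
qed

section \<open>Hyperbolic geodesics\<close>

lemma biholomorphism_inverse:
  fixes h :: "complex \<Rightarrow> complex"
  assumes hol: "h holomorphic_on S" and "open S" and bij: "bij_betw h S T"
  obtains k where "k holomorphic_on T" "bij_betw k T S" "\<And>z. z \<in> S \<Longrightarrow> k (h z) = z"
    "\<And>z. z \<in> S \<Longrightarrow> deriv h z * deriv k (h z) = 1"
proof -
  have inj: "inj_on h S" and im: "h ` S = T" using bij by (auto simp: bij_betw_def)
  obtain k where k: "k holomorphic_on h ` S" "\<And>z. z \<in> S \<Longrightarrow> deriv h z * deriv k (h z) = 1"
      "\<And>z. z \<in> S \<Longrightarrow> k (h z) = z"
    using holomorphic_has_inverse[OF hol \<open>open S\<close> inj] by metis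
  have "bij_betw k T S"
    using k(3) im by (intro bij_betw_byWitness[where f' = h]) (auto simp: image_subset_iff)
  then show thesis using k im by (intro that) auto
qed

text \<open>The map picked by \<open>SOME\<close> differs from the inverse of \<open>h\<close> by a
  disc automorphism. The infinitesimal Schwarz-Pick inequality for this automorphism and for its
  inverse forces equality.\<close>

lemma hyperbolic_density_biholomorphism:
  assumes hol: "h holomorphic_on ball 0 1" and bij: "bij_betw h (ball 0 1) \<Omega>" and z: "norm z < 1"
  shows "hyperbolic_density \<Omega> (h z) * norm (deriv h z) = 2 / (1 - (norm z)\<^sup>2)"
proof -
  have inj: "inj_on h (ball 0 1)" and im: "h ` ball 0 1 = \<Omega>"
    using bij by (auto simp: bij_betw_def)
  have ex: "\<exists>G. riemann_map \<Omega> G"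
    unfolding riemann_map_def using biholomorphism_inverse[OF hol open_ball bij] by metis
  define G where "G = (SOME G. riemann_map \<Omega> G)"
  have "riemann_map \<Omega> G" unfolding G_def by (rule someI_ex[OF ex])
  then have G: "G holomorphic_on \<Omega>" "bij_betw G \<Omega> (ball 0 1)" by (auto simp: riemann_map_def)
  have op: "open \<Omega>" using open_mapping_thm3[OF hol open_ball inj] im by simp
  define \<phi> where "\<phi> = G \<circ> h"
  have \<phi>_hol: "\<phi> holomorphic_on ball 0 1"
    unfolding \<phi>_def by (rule holomorphic_on_compose_gen[OF hol G(1)]) (simp add: im)
  have \<phi>_bij: "bij_betw \<phi> (ball 0 1) (ball 0 1)"
    unfolding \<phi>_def by (rule bij_betw_trans[OF bij G(2)])
  obtain \<psi> where \<psi>: "\<psi> holomorphic_on ball 0 1" "bij_betw \<psi> (ball 0 1) (ball 0 1)"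
    "\<And>z. z \<in> ball 0 1 \<Longrightarrow> \<psi> (\<phi> z) = z" "\<And>z. z \<in> ball 0 1 \<Longrightarrow> deriv \<phi> z * deriv \<psi> (\<phi> z) = 1"
    using biholomorphism_inverse[OF \<phi>_hol open_ball \<phi>_bij] by metis
  have \<phi>_im: "\<phi> ` ball 0 1 = ball 0 1" and \<psi>_im: "\<psi> ` ball 0 1 \<subseteq> ball 0 1"
    using bij_betw_imp_surj_on[OF \<phi>_bij] bij_betw_imp_surj_on[OF \<psi>(2)] by auto
  have zb: "z \<in> ball 0 1" using z by simp
  then have \<phi>z: "norm (\<phi> z) < 1" using \<phi>_im by (metis imageI mem_ball_0)
  have le1: "norm (deriv \<phi> z) / (1 - (norm (\<phi> z))\<^sup>2) \<le> 1 / (1 - (norm z)\<^sup>2)"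
    by (rule Schwarz_Pick_deriv[OF \<phi>_hol _ z]) (simp add: \<phi>_im)
  have le2: "norm (deriv \<psi> (\<phi> z)) / (1 - (norm z)\<^sup>2) \<le> 1 / (1 - (norm (\<phi> z))\<^sup>2)"
    using Schwarz_Pick_deriv[OF \<psi>(1) \<psi>_im \<phi>z] \<psi>(3)[OF zb] by simp
  have prod: "norm (deriv \<phi> z) * norm (deriv \<psi> (\<phi> z)) = 1"
    using \<psi>(4)[OF zb] by (metis norm_mult norm_one)
  have "norm (deriv \<phi> z) / (1 - (norm (\<phi> z))\<^sup>2) = 1 / (1 - (norm z)\<^sup>2)"
  proof (rule antisym[OF le1])
    have "norm (deriv \<phi> z) * (norm (deriv \<psi> (\<phi> z)) / (1 - (norm z)\<^sup>2))
        \<le> norm (deriv \<phi> z) * (1 / (1 - (norm (\<phi> z))\<^sup>2))"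
      using le2 by (rule mult_left_mono) simp
    then show "1 / (1 - (norm z)\<^sup>2) \<le> norm (deriv \<phi> z) / (1 - (norm (\<phi> z))\<^sup>2)"
      using prod by simp
  qed
  moreover have "deriv \<phi> z = deriv G (h z) * deriv h z"
    unfolding \<phi>_def
    using hol G(1) zb op im
    by (intro deriv_chain) (auto simp: holomorphic_on_imp_differentiable_at)
  ultimately show ?thesis
    by (simp add: hyperbolic_density_def G_def[symmetric] Let_def \<phi>_def norm_mult)
qed

section \<open>Lengths of curves and minimality of geodesics\<close>

text \<open>The derivative may be unbounded near exceptional points. The fundamental theorem is
  therefore used for the gauge integral, and the Bochner integral enters only when the length is
  finite; otherwise the bound is trivial.\<close>

lemma valid_path_norm_diff_le_nn_integral:
  fixes \<eta> :: "real \<Rightarrow> complex"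
  assumes "valid_path \<eta>"
  shows "ennreal (norm (\<eta> 1 - \<eta> 0))
    \<le> (\<integral>\<^sup>+u\<in>{0..1}. ennreal (norm (vector_derivative \<eta> (at u))) \<partial>lborel)"
proof -
  obtain S where S: "finite S" "\<eta> C1_differentiable_on {0..1} - S" and cont: "continuous_on {0..1} \<eta>"
    using assms unfolding valid_path_def piecewise_C1_differentiable_on_def by blast
  define A where "A = {0<..<1} - S"
  have A: "A \<in> sets borel" unfolding A_def using S(1) by (simp add: finite_imp_closed borel_closed sets.Diff)
  let ?D = "\<lambda>u. vector_derivative \<eta> (at u)"
  have deriv: "(\<eta> has_vector_derivative ?D u) (at u)" if "u \<in> A" for u
    using S(2) that unfolding C1_differentiable_on_eq A_def
    by (meson Diff_iff atLeastAtMost_iff greaterThanLessThan_iff less_imp_le vector_derivative_works)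
  have cD: "continuous_on A ?D"
    using S(2) unfolding C1_differentiable_on_eq A_def by (rule conjE) (erule continuous_on_subset, auto)
  \<comment> \<open>The derivative is cut off outside \<open>A\<close>, where it is continuous,
    which makes it Borel measurable on the whole line.\<close>
  define f where "f u = indicator A u *\<^sub>R ?D u" for u
  have f_meas: "f \<in> borel_measurable borel"
    unfolding f_def using A cD by (rule borel_measurable_continuous_on_indicator)
  have "(f has_integral (\<eta> 1 - \<eta> 0)) {0..1}"
  proof (rule fundamental_theorem_of_calculus_interior_strong[of "S \<union> {0, 1}"])
    show "(\<eta> has_vector_derivative f u) (at u)" if "u \<in> {0<..<1} - (S \<union> {0, 1})" for u
      using deriv[of u] that by (simp add: f_def A_def)
  qed (use S cont in auto)
  then have f_int: "(f has_integral (\<eta> 1 - \<eta> 0)) UNIV"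
    by (rule has_integral_on_superset) (auto simp: f_def A_def)
  have le: "(\<integral>\<^sup>+u. ennreal (norm (f u)) \<partial>lborel)
      \<le> (\<integral>\<^sup>+u\<in>{0..1}. ennreal (norm (?D u)) \<partial>lborel)"
    by (intro nn_integral_mono) (auto simp: f_def A_def indicator_def)
  show ?thesis
  proof (cases "(\<integral>\<^sup>+u. ennreal (norm (f u)) \<partial>lborel) = \<infinity>")
    case True
    then show ?thesis using le by (simp add: top_unique)
  next
    case False
    then have int: "integrable lborel f"
      using f_meas by (intro integrableI_bounded) (auto simp: less_top)
    then have "(f has_integral (integral\<^sup>L lborel f)) UNIV"
      by (rule has_integral_integral_lborel)
    then have "\<eta> 1 - \<eta> 0 = integral\<^sup>L lborel f" using f_int by (metis has_integral_unique)
    then have "norm (\<eta> 1 - \<eta> 0) \<le> (\<integral>u. norm (f u) \<partial>lborel)" by simp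
    then have "ennreal (norm (\<eta> 1 - \<eta> 0)) \<le> ennreal (\<integral>u. norm (f u) \<partial>lborel)"
      by (rule ennreal_leI)
    also have "\<dots> = (\<integral>\<^sup>+u. ennreal (norm (f u)) \<partial>lborel)"
      using int by (intro nn_integral_eq_integral[symmetric]) auto
    finally show ?thesis using le by simp
  qed
qed

text \<open>A calibration: a holomorphic function whose derivative is dominated by the density
  bounds from below the length of every competitor with the same end points.\<close>

lemma norm_diff_le_hyperbolic_length:
  assumes op: "open \<Omega>" and hol: "k holomorphic_on \<Omega>"
    and le: "\<And>w. w \<in> \<Omega> \<Longrightarrow> norm (deriv k w) \<le> hyperbolic_density \<Omega> w"
    and \<sigma>: "valid_path \<sigma>" "path_image \<sigma> \<subseteq> \<Omega>"
  shows "ennreal (norm (k (pathfinish \<sigma>) - k (pathstart \<sigma>))) \<le> hyperbolic_length \<Omega> \<sigma> 0 1"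
proof -
  have "valid_path (k \<circ> \<sigma>)"
    by (rule valid_path_compose_holomorphic[OF \<sigma>(1) hol op \<sigma>(2)])
  from valid_path_norm_diff_le_nn_integral[OF this]
  have "ennreal (norm (k (pathfinish \<sigma>) - k (pathstart \<sigma>)))
      \<le> (\<integral>\<^sup>+u\<in>{0..1}. ennreal (norm (vector_derivative (k \<circ> \<sigma>) (at u))) \<partial>lborel)"
    by (simp add: pathfinish_def pathstart_def)
  also have "\<dots> \<le> hyperbolic_length \<Omega> \<sigma> 0 1"
    unfolding hyperbolic_length_def
  proof (rule nn_integral_mono_AE)
    obtain S where S: "finite S" "\<sigma> C1_differentiable_on {0..1} - S"
      using \<sigma>(1) unfolding valid_path_def piecewise_C1_differentiable_on_def by blast
    have pt: "norm (vector_derivative (k \<circ> \<sigma>) (at u))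
        \<le> hyperbolic_density \<Omega> (\<sigma> u) * norm (vector_derivative \<sigma> (at u))" if "u \<in> {0..1} - S" for u
    proof -
      have "\<sigma> u \<in> \<Omega>" using \<sigma>(2) that by (auto simp: path_image_def)
      moreover have "\<sigma> differentiable (at u)"
        using S(2) that by (auto simp: C1_differentiable_on_eq)
      ultimately have "vector_derivative (k \<circ> \<sigma>) (at u) = vector_derivative \<sigma> (at u) * deriv k (\<sigma> u)"
        using hol op by (intro vector_derivative_chain_at_general)
          (auto simp: holomorphic_on_imp_differentiable_at)
      then show ?thesis
        using le[OF \<open>\<sigma> u \<in> \<Omega>\<close>] by (simp add: norm_mult mult.commute mult_right_mono)
    qed
    have "AE u in lborel. u \<notin> S"
      using S(1) by (intro AE_not_in finite_imp_null_set_lborel)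
    then show "AE u in lborel. ennreal (norm (vector_derivative (k \<circ> \<sigma>) (at u))) * indicator {0..1} u
       \<le> ennreal (hyperbolic_density \<Omega> (\<sigma> u) * norm (vector_derivative \<sigma> (at u))) * indicator {0..1} u"
      by eventually_elim (auto simp: indicator_def intro!: ennreal_leI pt)
  qed
  finally show ?thesis .
qed

text \<open>The chain rule factor of the logarithm of (1 + z) / (1 - z), over any field because it
  occurs for complex and for real arguments.\<close>

lemma inverse_Cayley_mult:
  fixes z :: "'a :: field"
  assumes "1 - z \<noteq> 0" "1 + z \<noteq> 0"
  shows "inverse ((1 + z) / (1 - z)) * (2 / (1 - z)\<^sup>2) = 2 / (1 - z\<^sup>2)"
proof -
  have "1 - z\<^sup>2 = (1 - z) * (1 + z)" by (simp add: power2_eq_square algebra_simps)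
  then show ?thesis using assms by (simp only:) (simp add: divide_simps power2_eq_square)
qed

text \<open>The logarithm \<open>Ln ((1 + z) / (1 - z))\<close> maps the disc to a strip.  It does not increase the
  hyperbolic length element and preserves it on the real diameter.\<close>
lemma geodesic_segment_radius:
  assumes hol: "h holomorphic_on ball 0 1" and bij: "bij_betw h (ball 0 1) \<Omega>" and r: "0 < r" "r < 1"
  shows "geodesic_segment \<Omega> r (\<lambda>u. h (of_real u))"
proof -
  have inj: "inj_on h (ball 0 1)" and im: "h ` ball 0 1 = \<Omega>"
    using bij by (auto simp: bij_betw_def)
  have op: "open \<Omega>" using open_mapping_thm3[OF hol open_ball inj] im by simp
  obtain k where k: "k holomorphic_on \<Omega>" "bij_betw k \<Omega> (ball 0 1)"
      "\<And>z. z \<in> ball 0 1 \<Longrightarrow> k (h z) = z" "\<And>z. z \<in> ball 0 1 \<Longrightarrow> deriv h z * deriv k (h z) = 1"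
    using biholomorphism_inverse[OF hol open_ball bij] by metis
  let ?\<gamma> = "\<lambda>u. h (of_real u)"
  have rb: "of_real u \<in> ball (0::complex) 1" if "u \<in> {0..r}" for u using that r by auto
  have vd: "(?\<gamma> has_vector_derivative deriv h (of_real u)) (at u)" if "u \<in> {0..r}" for u
  proof -
    have "(h has_field_derivative deriv h (of_real u)) (at (of_real u))"
      using hol rb[OF that] by (intro holomorphic_derivI[of _ "ball 0 1"]) auto
    then show ?thesis
      by (rule has_vector_derivative_real_field)
  qed
  have h': "deriv h holomorphic_on ball 0 1" using hol by (intro holomorphic_deriv) auto
  have "?\<gamma> C1_differentiable_on {0..r}"
    unfolding C1_differentiable_on_def
    using vd rb by (intro exI[of _ "\<lambda>u. deriv h (of_real u)"])
      (auto intro!: continuous_on_compose2[OF holomorphic_on_imp_continuous_on[OF h']] continuous_intros)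
  then have C1: "?\<gamma> piecewise_C1_differentiable_on {0..r}"
    by (rule C1_differentiable_imp_piecewise)
  define L where "L z = Ln ((1 + z) / (1 - z))" for z :: complex
  have Re_pos: "0 < Re ((1 + z) / (1 - z))" if z: "norm z < 1" for z
  proof -
    have "1 - z \<noteq> 0" using z by auto
    then show ?thesis
      using Re_Cayley[of 1 z] one_minus_norm_square_pos[OF z] by simp
  qed
  have L_DERIV: "(L has_field_derivative 2 / (1 - z\<^sup>2)) (at z)" if z: "norm z < 1" for z
  proof -
    have "z \<noteq> 1" "z \<noteq> -1" using z by auto
    then have nz: "1 - z \<noteq> 0" "1 + z \<noteq> 0" by (auto simp: add_eq_0_iff)
    have "(1 + z) / (1 - z) \<notin> \<real>\<^sub>\<le>\<^sub>0"
      using Re_pos[OF z] by (auto simp: complex_nonpos_Reals_iff)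
    then have "(L has_field_derivative inverse ((1 + z) / (1 - z)) * (2 / (1 - z)\<^sup>2)) (at z)"
      unfolding L_def using nz
      by (auto intro!: derivative_eq_intros simp: field_simps power2_eq_square)
    then show ?thesis by (simp only: inverse_Cayley_mult[OF nz])
  qed
  have L_hol: "L holomorphic_on ball 0 1"
    unfolding holomorphic_on_open[OF open_ball] using L_DERIV by (metis mem_ball_0)
  have kb: "k ` \<Omega> \<subseteq> ball 0 1" using k(3) im by (auto simp: image_subset_iff)
  have Lk_hol: "(L \<circ> k) holomorphic_on \<Omega>"
    by (rule holomorphic_on_compose_gen[OF k(1) L_hol kb])
  have Lk_le: "norm (deriv (L \<circ> k) w) \<le> hyperbolic_density \<Omega> w" if w: "w \<in> \<Omega>" for w
  proof -
    obtain z where z: "norm z < 1" "w = h z" using w im by auto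
    have kw: "k w = z" using k(3) z by simp
    have "deriv (L \<circ> k) w = deriv L z * deriv k w"
      using k(1) op w L_hol z kw unfolding kw[symmetric]
      by (intro deriv_chain) (auto simp: holomorphic_on_imp_differentiable_at)
    also have "deriv L z = 2 / (1 - z\<^sup>2)" by (rule DERIV_imp_deriv[OF L_DERIV[OF z(1)]])
    \<comment> \<open>The density is known only after multiplication by |h'(z)|, so both sides carry
      this non-zero factor until the end.\<close>
    finally have "norm (deriv (L \<circ> k) w) * norm (deriv h z) = norm (2 / (1 - z\<^sup>2)) * norm (deriv h z * deriv k w)"
      by (simp only: norm_mult mult_ac)
    also have "deriv h z * deriv k w = 1" using k(4) z by simp
    also have "norm (2 / (1 - z\<^sup>2)) * norm (1::complex) \<le> 2 / (1 - (norm z)\<^sup>2)"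
      using norm_triangle_ineq2[of 1 "z\<^sup>2"] one_minus_norm_square_pos[OF z(1)]
      by (simp add: norm_divide norm_power frac_le)
    also have "\<dots> = hyperbolic_density \<Omega> w * norm (deriv h z)"
      using hyperbolic_density_biholomorphism[OF hol bij z(1)] z(2) by simp
    finally have "norm (deriv (L \<circ> k) w) * norm (deriv h z) \<le> hyperbolic_density \<Omega> w * norm (deriv h z)" .
    moreover have "deriv h z \<noteq> 0" using k(4)[of z] z(1) by force
    ultimately show ?thesis by (simp only: mult_le_cancel_right norm_le_zero_iff norm_ge_zero zero_less_norm_iff) simp
  qed
  \<comment> \<open>On the radius the calibration is exact: its real restriction \<open>F\<close> is
    a primitive of the pulled-back density.\<close>
  have len: "hyperbolic_length \<Omega> ?\<gamma> s t = ennreal (norm ((L \<circ> k) (?\<gamma> t) - (L \<circ> k) (?\<gamma> s)))"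
    if st: "0 \<le> s" "s \<le> t" "t \<le> r" for s t
  proof -
    define F where "F u = ln ((1 + u) / (1 - u))" for u :: real
    have LF: "(L \<circ> k) (?\<gamma> u) = of_real (F u)" if "u \<in> {0..r}" for u
    proof -
      have "0 < (1 + u) / (1 - u)" using that r by simp
      then have "Ln (of_real ((1 + u) / (1 - u))) = of_real (F u)"
        unfolding F_def by (rule Ln_of_real)
      then show ?thesis using k(3)[OF rb[OF that]] by (simp add: L_def)
    qed
    have F_DERIV: "(F has_real_derivative 2 / (1 - u\<^sup>2)) (at u)" if "u \<in> {0..r}" for u
    proof -
      have nz: "1 - u > 0" "1 + u > 0" using that r by auto
      have "(F has_real_derivative inverse ((1 + u) / (1 - u)) * (2 / (1 - u)\<^sup>2)) (at u)"
        unfolding F_def using nz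
        by (auto intro!: derivative_eq_intros simp: field_simps power2_eq_square)
      then show ?thesis by (subst (asm) inverse_Cayley_mult) (use nz in auto)
    qed
    have F'_nonneg: "0 \<le> 2 / (1 - u\<^sup>2)" if "u \<in> {0..r}" for u
      using that r by (simp add: abs_square_le_1)
    have "hyperbolic_length \<Omega> ?\<gamma> s t = (\<integral>\<^sup>+u. ennreal (2 / (1 - u\<^sup>2)) * indicator {s..t} u \<partial>lborel)"
      unfolding hyperbolic_length_def
    proof (rule nn_integral_cong)
      fix u
      show "ennreal (hyperbolic_density \<Omega> (?\<gamma> u) * norm (vector_derivative ?\<gamma> (at u))) * indicator {s..t} u
          = ennreal (2 / (1 - u\<^sup>2)) * indicator {s..t} u"
      proof (cases "u \<in> {s..t}")
        case True
        then have u: "u \<in> {0..r}" using st by auto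
        show ?thesis
          using hyperbolic_density_biholomorphism[OF hol bij, of "of_real u"] rb[OF u]
          by (simp add: vector_derivative_at[OF vd[OF u]])
      qed simp
    qed
    also have "\<dots> = ennreal (F t - F s)"
      using st F_DERIV F'_nonneg by (intro nn_integral_FTC_Icc) auto
    also have "F t - F s = norm ((L \<circ> k) (?\<gamma> t) - (L \<circ> k) (?\<gamma> s))"
    proof -
      have "F s \<le> F t"
      proof (rule DERIV_nonneg_imp_nondecreasing[OF st(2)])
        fix u assume "s \<le> u" "u \<le> t"
        then have "u \<in> {0..r}" using st by auto
        then show "\<exists>y. (F has_real_derivative y) (at u) \<and> 0 \<le> y" using F_DERIV F'_nonneg by blast
      qed
      moreover have "(L \<circ> k) (?\<gamma> t) - (L \<circ> k) (?\<gamma> s) = of_real (F t - F s)"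
        using LF[of s] LF[of t] st by simp
      ultimately show ?thesis by (simp only: norm_of_real)
    qed
    finally show ?thesis .
  qed
  show ?thesis
    unfolding geodesic_segment_def
  proof (intro conjI allI impI)
    show "?\<gamma> ` {0..r} \<subseteq> \<Omega>" using rb im by blast
    fix s t \<sigma>
    assume st: "0 \<le> s \<and> s \<le> t \<and> t \<le> r"
      and \<sigma>: "valid_path \<sigma> \<and> path_image \<sigma> \<subseteq> \<Omega> \<and> pathstart \<sigma> = ?\<gamma> s \<and> pathfinish \<sigma> = ?\<gamma> t"
    then show "hyperbolic_length \<Omega> ?\<gamma> s t \<le> hyperbolic_length \<Omega> \<sigma> 0 1"
      using norm_diff_le_hyperbolic_length[OF op Lk_hol Lk_le, of \<sigma>] len[of s t] by simp
  qed (use r C1 in auto)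
qed

text \<open>For \<open>c > 1\<close> the condition \<open>2 c Re p > 1 + |p|\<^sup>2\<close> describes a hyperbolic half-plane near \<open>1\<close>,
  bounded by a circle orthogonal to the unit circle; half-planes are geodesically convex.\<close>
lemma hyperbolic_half_plane_convex:
  fixes z e :: complex
  assumes z: "norm z < 1" and e: "norm e = 1" and u: "0 \<le> u" "u \<le> r" "0 < r" "r < 1"
    and p: "\<And>u. p u = (e * of_real u + z) / (1 + cnj z * (e * of_real u))"
    and start: "1 + (norm z)\<^sup>2 < 2 * c * Re z" and finish: "1 + (norm (p r))\<^sup>2 < 2 * c * Re (p r)"
  shows "1 + (norm (p u))\<^sup>2 < 2 * c * Re (p u)"
proof -
  \<comment> \<open>\<open>p\<close> runs along the geodesic from \<open>z\<close>. After
    multiplication by |d v|^2 the half-plane condition becomes positivity of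
    \<open>(1 + v\<^sup>2) * \<alpha> + v * \<beta>\<close>, where \<open>\<alpha>\<close> is the
    value at the starting point.\<close>
  define \<alpha> where "\<alpha> = 2 * c * Re z - 1 - (norm z)\<^sup>2"
  define \<beta> where "\<beta> = 2 * c * Re (e + z\<^sup>2 * cnj e) - 4 * Re (cnj z * e)"
  define d where "d u = 1 + cnj z * (e * of_real u)" for u :: real
  define Q where "Q u = 2 * c * Re (p u) - 1 - (norm (p u))\<^sup>2" for u
  have d: "d v \<noteq> 0" if "0 \<le> v" "v < 1" for v
  proof -
    have "norm (- (e * of_real v)) < 1" using that e by (simp add: norm_mult)
    from one_minus_cnj_mult_nonzero[OF z this] show ?thesis by (simp add: d_def)
  qed
  have Q: "Q v * (norm (d v))\<^sup>2 = (1 + v\<^sup>2) * \<alpha> + v * \<beta>" if v: "0 \<le> v" "v < 1" for v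
  proof -
    let ?N = "e * of_real v + z"
    have e1: "(Re e)\<^sup>2 + (Im e)\<^sup>2 = 1" using e by (simp add: cmod_def)
    have "p v = ?N * cnj (d v) / (norm (d v))\<^sup>2"
      unfolding p d_def[symmetric] by (rule complex_div_cnj)
    then have "Re (p v) * (norm (d v))\<^sup>2 = Re (?N * cnj (d v))"
      using d[OF v] by (metis Re_divide_of_real nonzero_eq_divide_eq norm_eq_zero of_real_power power_not_zero)
    moreover have "(norm (p v))\<^sup>2 * (norm (d v))\<^sup>2 = (norm ?N)\<^sup>2"
      using d[OF v] by (simp add: p d_def[symmetric] norm_divide power_divide)
    ultimately have "Q v * (norm (d v))\<^sup>2 = 2 * c * Re (?N * cnj (d v)) - (norm (d v))\<^sup>2 - (norm ?N)\<^sup>2"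
      by (simp only: Q_def left_diff_distrib mult.assoc mult_1)
    also have "Re (?N * cnj (d v)) = v * Re (e + z\<^sup>2 * cnj e) + (1 + v\<^sup>2) * Re z"
      using e1 by (simp add: d_def power2_eq_square) algebra
    also have "(norm (d v))\<^sup>2 + (norm ?N)\<^sup>2 = (1 + v\<^sup>2) * (1 + (norm z)\<^sup>2) + 4 * v * Re (cnj z * e)"
      using e1 by (simp add: d_def cmod_power2) algebra
    then have "- (norm (d v))\<^sup>2 - (norm ?N)\<^sup>2 = - ((1 + v\<^sup>2) * (1 + (norm z)\<^sup>2)) - 4 * v * Re (cnj z * e)"
      by simp
    then have "2 * c * (v * Re (e + z\<^sup>2 * cnj e) + (1 + v\<^sup>2) * Re z) - (norm (d v))\<^sup>2 - (norm ?N)\<^sup>2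
        = 2 * c * (v * Re (e + z\<^sup>2 * cnj e) + (1 + v\<^sup>2) * Re z)
          - ((1 + v\<^sup>2) * (1 + (norm z)\<^sup>2)) - 4 * v * Re (cnj z * e)" by linarith
    also have "\<dots> = (1 + v\<^sup>2) * \<alpha> + v * \<beta>"
      by (simp add: \<alpha>_def \<beta>_def algebra_simps)
    finally show ?thesis .
  qed
  have \<alpha>: "0 < \<alpha>" using start by (simp add: \<alpha>_def)
  have "0 < Q r * (norm (d r))\<^sup>2" using finish d[of r] u by (simp add: Q_def)
  then have r_pos: "0 < (1 + r\<^sup>2) * \<alpha> + r * \<beta>" using Q[of r] u by simp
  have "0 < (1 + u\<^sup>2) * \<alpha> + u * \<beta>"
  proof (cases "u = 0")
    case False
    \<comment> \<open>For positive \<open>\<alpha>\<close>, the form divided by v is \<alpha> (1/v +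
      v) + \<beta>, which decreases on (0, 1). Positivity at \<open>r\<close> thus passes to smaller
      \<open>u\<close>; the added product is this monotonicity with denominators cleared.\<close>
    then have "0 < u * ((1 + r\<^sup>2) * \<alpha> + r * \<beta>)" using r_pos u by simp
    also have "\<dots> \<le> u * ((1 + r\<^sup>2) * \<alpha> + r * \<beta>) + \<alpha> * ((r - u) * (1 - u * r))"
      using \<alpha> u by (simp add: mult_le_one)
    also have "\<dots> = r * ((1 + u\<^sup>2) * \<alpha> + u * \<beta>)" by (simp add: algebra_simps power2_eq_square)
    finally show ?thesis using u by (simp add: zero_less_mult_iff)
  qed (use \<alpha> in simp)
  then have "0 < Q u * (norm (d u))\<^sup>2" using Q[of u] u by simp
  then have "0 < Q u" by (simp add: zero_less_mult_iff)
  then show ?thesis by (simp add: Q_def)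
qed

section \<open>Boundary behaviour of the Riemann map\<close>

lemma to_sphere_in_riemann_sphere: "to_sphere z \<in> riemann_sphere"
proof -
  define s where "s = (norm z)\<^sup>2"
  have s: "0 \<le> s" by (simp add: s_def)
  have "(norm (2 * z / of_real (1 + s)))\<^sup>2 = 4 * s / (1 + s)\<^sup>2"
    using s by (simp add: norm_divide norm_mult power_divide power_mult_distrib s_def
        del: of_real_add flip: norm_power)
  moreover have "4 * s / (1 + s)\<^sup>2 + ((s - 1) / (s + 1))\<^sup>2 = 1"
    using s by (simp add: power_divide add_divide_distrib[symmetric] add.commute)
      (simp add: power2_eq_square algebra_simps)
  ultimately show ?thesis
    by (simp add: riemann_sphere_def to_sphere_def norm_Pair s_def[symmetric] del: of_real_add flip: abs_divide)
qed

lemma inj_to_sphere: "inj to_sphere"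
proof (rule injI)
  fix z w assume eq: "to_sphere z = to_sphere w"
  have "((norm z)\<^sup>2 - 1) / ((norm z)\<^sup>2 + 1) = ((norm w)\<^sup>2 - 1) / ((norm w)\<^sup>2 + 1)"
    using eq by (simp add: to_sphere_def)
  moreover have "(norm z)\<^sup>2 + 1 > 0" "(norm w)\<^sup>2 + 1 > 0" by (simp_all add: add_nonneg_pos)
  ultimately have n: "(norm z)\<^sup>2 = (norm w)\<^sup>2" by (simp add: field_simps)
  have "complex_of_real (1 + (norm w)\<^sup>2) \<noteq> 0"
    using \<open>(norm w)\<^sup>2 + 1 > 0\<close> by (simp only: of_real_eq_0_iff)
  moreover have "2 * z / of_real (1 + (norm w)\<^sup>2) = 2 * w / of_real (1 + (norm w)\<^sup>2)"
    using eq unfolding to_sphere_def n by blast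
  ultimately show "z = w" by (simp only: divide_cancel_right mult_cancel_left) simp
qed

lemma isCont_to_sphere: "isCont to_sphere z"
proof -
  have "(norm u)\<^sup>2 + 1 \<noteq> 0" for u :: complex
    by (metis add_nonneg_pos less_irrefl zero_le_power2 zero_less_one)
  moreover have "complex_of_real (1 + (norm u)\<^sup>2) \<noteq> 0" for u :: complex
    using calculation[of u] by (simp only: of_real_eq_0_iff add.commute) simp
  ultimately show ?thesis
    unfolding to_sphere_def by (intro continuous_intros)
qed

lemma to_sphere_limit_in_sphere_boundary:
  assumes "\<And>n. w n \<in> \<Omega>" "w \<longlonglongrightarrow> a" "a \<notin> \<Omega>"
  shows "to_sphere a \<in> sphere_boundary \<Omega>"
proof -
  have lim: "(\<lambda>n. to_sphere (w n)) \<longlonglongrightarrow> to_sphere a"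
    by (rule isCont_tendsto_compose[OF isCont_to_sphere assms(2)])
  have "to_sphere a \<in> top_of_set riemann_sphere closure_of (to_sphere ` \<Omega>)"
    unfolding in_closure_of
  proof (intro conjI allI impI)
    fix T assume T: "to_sphere a \<in> T \<and> openin (top_of_set riemann_sphere) T"
    then obtain U where U: "open U" "T = riemann_sphere \<inter> U" by (auto simp: openin_open)
    then have "\<forall>\<^sub>F n in sequentially. to_sphere (w n) \<in> U"
      using lim T by (auto intro: topological_tendstoD)
    then obtain n where "to_sphere (w n) \<in> U" by (auto simp: eventually_sequentially)
    then show "\<exists>y. y \<in> to_sphere ` \<Omega> \<and> y \<in> T"
      using U(2) assms(1)[of n] to_sphere_in_riemann_sphere[of "w n"]
      by (intro exI[of _ "to_sphere (w n)"]) simp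
  qed (simp add: to_sphere_in_riemann_sphere)
  moreover have "to_sphere a \<notin> to_sphere ` \<Omega>"
    using assms(3) inj_to_sphere by (auto dest: injD)
  then have "to_sphere a \<notin> top_of_set riemann_sphere interior_of (to_sphere ` \<Omega>)"
    by (rule contra_subsetD[OF interior_of_subset])
  ultimately show ?thesis by (simp add: sphere_boundary_def frontier_of_def)
qed

text \<open>At a limit value inside \<open>\<Omega>\<close> the inverse map would be continuous and
  would send it to \<open>x\<close>, which is not in \<open>S\<close>.\<close>

lemma biholomorphism_boundary_value:
  assumes hol: "g holomorphic_on S" and "open S" and bij: "bij_betw g S \<Omega>"
    and z: "\<And>n. z n \<in> S" "z \<longlonglongrightarrow> x" "x \<notin> S" and lim: "(\<lambda>n. g (z n)) \<longlonglongrightarrow> a"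
  shows "a \<notin> \<Omega>"
proof
  assume a: "a \<in> \<Omega>"
  obtain k where k: "k holomorphic_on \<Omega>" "bij_betw k \<Omega> S" "\<And>z. z \<in> S \<Longrightarrow> k (g z) = z"
    using biholomorphism_inverse[OF hol \<open>open S\<close> bij] by metis
  have "open \<Omega>"
    using open_mapping_thm3[OF hol \<open>open S\<close>] bij by (auto simp: bij_betw_def)
  then have "isCont k a"
    using holomorphic_on_imp_continuous_on[OF k(1)] a by (simp add: continuous_on_eq_continuous_at)
  then have "(\<lambda>n. k (g (z n))) \<longlonglongrightarrow> k a" using lim by (rule isCont_tendsto_compose)
  then have "z \<longlonglongrightarrow> k a" using k(3) z(1) by simp
  then have "x = k a" using z(2) LIMSEQ_unique by blast
  then show False using z(3) k(2) a by (auto simp: bij_betw_def)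
qed

text \<open>Precomposing \<open>g\<close> with the automorphism \<open>\<psi>\<close> that takes 0
  to \<open>z\<close> and \<open>r\<close> to \<open>w\<close> reduces this to the real radius. The
  half-plane parameter \<open>c\<close> is quantified inside the conclusion because the geodesics
  are fixed before the compact set that determines \<open>c\<close>.\<close>

lemma geodesic_segment_between:
  assumes hol: "g holomorphic_on ball 0 1" and bij: "bij_betw g (ball 0 1) \<Omega>"
    and z: "norm z < 1" and w: "norm w < 1" and ne: "z \<noteq> w"
  obtains r \<gamma> where "geodesic_segment \<Omega> r \<gamma>" "\<gamma> 0 = g z" "\<gamma> r = g w"
    "\<And>c u. 1 + (norm z)\<^sup>2 < 2 * c * Re z \<Longrightarrow> 1 + (norm w)\<^sup>2 < 2 * c * Re w \<Longrightarrow> u \<in> {0..r} \<Longrightarrow>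
       \<exists>p. norm p < 1 \<and> \<gamma> u = g p \<and> 1 + (norm p)\<^sup>2 < 2 * c * Re p"
proof -
  define v where "v = Moebius_function 0 z w"
  define r where "r = norm v"
  define e where "e = v / of_real r"
  have r1: "r < 1" unfolding r_def v_def by (rule Moebius_function_norm_lt_1[OF z w])
  have "v \<noteq> 0" using ne one_minus_cnj_mult_nonzero[OF z w] by (simp add: v_def Moebius_function_def)
  then have r0: "0 < r" and e: "norm e = 1" and er: "e * of_real r = v"
    by (auto simp: r_def e_def norm_divide)
  have e0: "e \<noteq> 0" using e by auto
  define \<psi> where "\<psi> u = Moebius_function 0 (-z) (e * u)" for u
  have rot: "e * u \<in> ball 0 1 \<longleftrightarrow> norm u < 1" for u using e by (simp add: norm_mult)
  have \<psi>_bij: "bij_betw \<psi> (ball 0 1) (ball 0 1)"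
  proof (rule bij_betw_byWitness[where f' = "\<lambda>p. Moebius_function 0 z p / e"])
    show "\<forall>u\<in>ball 0 1. Moebius_function 0 z (\<psi> u) / e = u"
      using Moebius_function_compose[of z "-z"] z rot e0 by (simp add: \<psi>_def)
    show "\<forall>p\<in>ball 0 1. \<psi> (Moebius_function 0 z p / e) = p"
      using Moebius_function_compose[of "-z" z] z e0 by (simp add: \<psi>_def)
    show "\<psi> ` ball 0 1 \<subseteq> ball 0 1"
      using rot z by (auto simp: \<psi>_def intro!: Moebius_function_norm_lt_1)
    show "(\<lambda>p. Moebius_function 0 z p / e) ` ball 0 1 \<subseteq> ball 0 1"
      using z e by (auto simp: norm_divide intro!: Moebius_function_norm_lt_1)
  qed
  have "(Moebius_function 0 (-z) \<circ> (\<lambda>u. e * u)) holomorphic_on ball 0 1"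
    using rot z by (intro holomorphic_on_compose_gen[OF _ Moebius_function_holomorphic]
        holomorphic_intros) auto
  then have \<psi>_hol: "\<psi> holomorphic_on ball 0 1" by (simp add: \<psi>_def[abs_def] comp_def)
  have "(g \<circ> \<psi>) holomorphic_on ball 0 1"
    using \<psi>_bij by (intro holomorphic_on_compose_gen[OF \<psi>_hol hol]) (simp add: bij_betw_def)
  from geodesic_segment_radius[OF this bij_betw_trans[OF \<psi>_bij bij] r0 r1]
  have geo: "geodesic_segment \<Omega> r (\<lambda>u. g (\<psi> (of_real u)))" by simp
  have \<psi>r: "\<psi> (of_real r) = w"
    using Moebius_function_compose[of "-z" z w] z w by (simp add: \<psi>_def er v_def)
  have \<psi>_eq: "\<psi> (of_real u) = (e * of_real u + z) / (1 + cnj z * (e * of_real u))" for u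
    by (simp add: \<psi>_def Moebius_function_def)
  show thesis
  proof (rule that[OF geo])
    show "g (\<psi> (of_real 0)) = g z" by (simp add: \<psi>_def Moebius_function_def)
    show "g (\<psi> (of_real r)) = g w" by (simp add: \<psi>r)
    fix c u assume *: "1 + (norm z)\<^sup>2 < 2 * c * Re z" "1 + (norm w)\<^sup>2 < 2 * c * Re w" "u \<in> {0..r}"
    have "of_real u \<in> ball (0::complex) 1" using * r1 by auto
    then have "\<psi> (of_real u) \<in> ball 0 1" using \<psi>_bij by (auto simp: bij_betw_def)
    moreover have "1 + (norm (\<psi> (of_real u)))\<^sup>2 < 2 * c * Re (\<psi> (of_real u))"
      by (rule hyperbolic_half_plane_convex[where p = "\<lambda>u. \<psi> (of_real u)", OF z e _ _ r0 r1 \<psi>_eq *(1)])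
        (use * in \<open>auto simp: \<psi>r\<close>)
    ultimately show "\<exists>p. norm p < 1 \<and> g (\<psi> (of_real u)) = g p \<and> 1 + (norm p)\<^sup>2 < 2 * c * Re p"
      by (intro exI[of _ "\<psi> (of_real u)"]) simp
  qed
qed

text \<open>Geodesics between points close to \<open>1\<close> stay close to \<open>1\<close>, so two limits of \<open>g\<close> at \<open>1\<close> are
  joined by geodesics that leave every compact set.\<close>
lemma two_limits_imp_not_visible:
  assumes hol: "g holomorphic_on ball 0 1" and bij: "bij_betw g (ball 0 1) \<Omega>"
    and z: "\<And>n. norm (z n) < 1" "z \<longlonglongrightarrow> 1" "(\<lambda>n. g (z n)) \<longlonglongrightarrow> a"
    and w: "\<And>n. norm (w n) < 1" "w \<longlonglongrightarrow> 1" "(\<lambda>n. g (w n)) \<longlonglongrightarrow> b"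
    and ne: "\<And>n. z n \<noteq> w n" "a \<noteq> b"
  shows "\<not> visible_domain \<Omega>"
proof
  assume vis: "visible_domain \<Omega>"
  have g\<Omega>: "g u \<in> \<Omega>" if "norm u < 1" for u using bij that by (auto simp: bij_betw_def)
  have a: "to_sphere a \<in> sphere_boundary \<Omega>"
    using to_sphere_limit_in_sphere_boundary[OF g\<Omega>[OF z(1)] z(3)]
      biholomorphism_boundary_value[OF hol open_ball bij _ z(2) _ z(3)] z(1) by simp
  have b: "to_sphere b \<in> sphere_boundary \<Omega>"
    using to_sphere_limit_in_sphere_boundary[OF g\<Omega>[OF w(1)] w(3)]
      biholomorphism_boundary_value[OF hol open_ball bij _ w(2) _ w(3)] w(1) by simp
  have ab: "to_sphere a \<noteq> to_sphere b" using ne(2) inj_to_sphere by (auto dest: injD)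
  have "\<forall>n. \<exists>r \<gamma>. geodesic_segment \<Omega> r \<gamma> \<and> \<gamma> 0 = g (z n) \<and> \<gamma> r = g (w n) \<and>
     (\<forall>c u. 1 + (norm (z n))\<^sup>2 < 2 * c * Re (z n) \<longrightarrow> 1 + (norm (w n))\<^sup>2 < 2 * c * Re (w n) \<longrightarrow>
       u \<in> {0..r} \<longrightarrow> (\<exists>p. norm p < 1 \<and> \<gamma> u = g p \<and> 1 + (norm p)\<^sup>2 < 2 * c * Re p))"
    by (rule allI, rule geodesic_segment_between[OF hol bij z(1) w(1) ne(1)]) blast
  then obtain R \<gamma> where \<gamma>: "\<And>n. geodesic_segment \<Omega> (R n) (\<gamma> n)" "\<And>n. \<gamma> n 0 = g (z n)"
      "\<And>n. \<gamma> n (R n) = g (w n)"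
    and near: "\<And>n c u. 1 + (norm (z n))\<^sup>2 < 2 * c * Re (z n) \<Longrightarrow>
       1 + (norm (w n))\<^sup>2 < 2 * c * Re (w n) \<Longrightarrow> u \<in> {0..R n} \<Longrightarrow>
       \<exists>p. norm p < 1 \<and> \<gamma> n u = g p \<and> 1 + (norm p)\<^sup>2 < 2 * c * Re p"
    by metis
  have lims: "(\<lambda>n. to_sphere (\<gamma> n 0)) \<longlonglongrightarrow> to_sphere a" "(\<lambda>n. to_sphere (\<gamma> n (R n))) \<longlonglongrightarrow> to_sphere b"
    unfolding \<gamma>(2,3)
    by (intro isCont_tendsto_compose[OF isCont_to_sphere] z(3) w(3))+
  from vis[unfolded visible_domain_def, THEN bspec, OF a, THEN bspec, OF b, THEN mp, OF ab]
  obtain K where K: "compact K" "K \<subseteq> \<Omega>"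
    and meets: "\<forall>\<gamma> R. (\<forall>n. geodesic_segment \<Omega> (R n) (\<gamma> n)) \<and>
       (\<lambda>n. to_sphere (\<gamma> n 0)) \<longlonglongrightarrow> to_sphere a \<and> (\<lambda>n. to_sphere (\<gamma> n (R n))) \<longlonglongrightarrow> to_sphere b \<longrightarrow>
       (\<forall>\<^sub>F n in sequentially. \<gamma> n ` {0..R n} \<inter> K \<noteq> {})"
    by (elim exE conjE) (rule that)
  obtain k where k: "k holomorphic_on \<Omega>" "bij_betw k \<Omega> (ball 0 1)" "\<And>z. z \<in> ball 0 1 \<Longrightarrow> k (g z) = z"
    using biholomorphism_inverse[OF hol open_ball bij] by metis
  have "compact (k ` K)"
    using k(1) K holomorphic_on_imp_continuous_on holomorphic_on_subset
    by (blast intro: compact_continuous_image)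
  moreover have "k ` K \<subseteq> ball 0 1" using k(2) K(2) by (auto simp: bij_betw_def)
  ultimately obtain \<rho>' where \<rho>': "0 \<le> \<rho>'" "\<rho>' < 1" "k ` K \<subseteq> cball 0 \<rho>'"
    by (rule compact_subset_ball_imp_subset_cball)
  \<comment> \<open>The maximum makes the radius positive, so that \<open>c\<close> below can be
    formed.\<close>
  define \<rho> where "\<rho> = max \<rho>' (1 / 2)"
  have \<rho>: "0 < \<rho>" "\<rho> < 1" "k ` K \<subseteq> cball 0 \<rho>" using \<rho>' by (auto simp: \<rho>_def)
  \<comment> \<open>With this \<open>c\<close> the boundary of the half-plane crosses the real axis
    at \<open>\<rho>\<close>, and the half-plane misses the closed disc of radius
    \<open>\<rho>\<close>.\<close>
  define c where "c = (1 + \<rho>\<^sup>2) / (2 * \<rho>)"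
  have "0 < (1 - \<rho>)\<^sup>2" using \<rho> by simp
  then have c: "c > 1" using \<rho> by (simp add: c_def field_simps power2_eq_square)
  have ev: "\<forall>\<^sub>F n in sequentially. 1 + (norm (s n))\<^sup>2 < 2 * c * Re (s n)" if "s \<longlonglongrightarrow> 1" for s
  proof -
    have "(\<lambda>n. 2 * c * Re (s n) - (1 + (norm (s n))\<^sup>2)) \<longlonglongrightarrow> 2 * c * Re 1 - (1 + (norm (1::complex))\<^sup>2)"
      using that by (intro tendsto_intros)
    moreover have "0 < 2 * c * Re 1 - (1 + (norm (1::complex))\<^sup>2)" using c by simp
    ultimately have "\<forall>\<^sub>F n in sequentially. 0 < 2 * c * Re (s n) - (1 + (norm (s n))\<^sup>2)"
      by (rule order_tendstoD(1))
    then show ?thesis by eventually_elim simp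
  qed
  have "\<forall>\<^sub>F n in sequentially. \<gamma> n ` {0..R n} \<inter> K \<noteq> {}"
    by (rule meets[rule_format]) (use \<gamma>(1) lims in simp)
  with ev[OF z(2)] ev[OF w(2)] have "\<forall>\<^sub>F n in sequentially. False"
  proof eventually_elim
    case (elim n)
    then obtain u where u: "u \<in> {0..R n}" "\<gamma> n u \<in> K" by blast
    obtain p where p: "norm p < 1" "\<gamma> n u = g p" "1 + (norm p)\<^sup>2 < 2 * c * Re p"
      using near[OF elim(1,2) u(1)] by blast
    have "p \<in> k ` K" using p u(2) k(3)[of p] by (metis imageI mem_ball_0)
    then have p\<rho>: "norm p \<le> \<rho>" using \<rho>(3) by auto
    have "2 * c * Re p \<le> 2 * c * norm p" using c complex_Re_le_cmod[of p] by simp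
    moreover have "2 * c = (1 + \<rho>\<^sup>2) / \<rho>" using \<rho>(1) by (simp add: c_def field_simps)
    ultimately have "1 + (norm p)\<^sup>2 < (1 + \<rho>\<^sup>2) / \<rho> * norm p" using p(3) by simp
    then have "(1 + (norm p)\<^sup>2) * \<rho> < (1 + \<rho>\<^sup>2) * norm p" using \<rho>(1) by (simp add: field_simps)
    moreover have "0 \<le> (\<rho> - norm p) * (1 - norm p * \<rho>)"
      using p\<rho> \<rho> p(1) by (intro mult_nonneg_nonneg) (auto simp: mult_le_one)
    ultimately show False by (simp add: algebra_simps power2_eq_square)
  qed
  then show False by simp
qed

text \<open>The self-map is conjugated to the disc, where the orbits of a compact set enter
  \<open>x\<close> inside one horodisc. The horodisc grows with the compact set, so it has to be
  shown that all of them give the same limit.\<close>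

lemma horodisc_limits_imp_denjoy_wolff_property:
  assumes hol: "g holomorphic_on ball 0 1" and bij: "bij_betw g (ball 0 1) \<Omega>"
    and lim: "\<And>x R. norm x = 1 \<Longrightarrow> \<exists>a. (g \<longlongrightarrow> a) (at x within horodisc x R \<inter> ball 0 1)"
  shows "denjoy_wolff_property \<Omega>"
  unfolding denjoy_wolff_property_def
proof (intro allI impI)
  fix f assume f: "f holomorphic_on \<Omega> \<and> f ` \<Omega> \<subseteq> \<Omega> \<and> (\<forall>z\<in>\<Omega>. f z \<noteq> z)"
  have im: "g ` ball 0 1 = \<Omega>" using bij by (simp add: bij_betw_def)
  obtain k where k: "k holomorphic_on \<Omega>" "bij_betw k \<Omega> (ball 0 1)" "\<And>z. z \<in> ball 0 1 \<Longrightarrow> k (g z) = z"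
    using biholomorphism_inverse[OF hol open_ball bij] by metis
  have gk: "g (k y) = y" if "y \<in> \<Omega>" for y using k(3) im that by auto
  have kb: "k y \<in> ball 0 1" if "y \<in> \<Omega>" for y using k(2) that by (auto simp: bij_betw_def)
  define \<phi> where "\<phi> = k \<circ> f \<circ> g"
  have "(k \<circ> (f \<circ> g)) holomorphic_on ball 0 1"
    using f im k(1) by (intro holomorphic_on_compose_gen[OF holomorphic_on_compose_gen[OF hol]]) auto
  then have \<phi>_hol: "\<phi> holomorphic_on ball 0 1" by (simp add: \<phi>_def comp_assoc)
  have \<phi>_maps: "\<phi> ` ball 0 1 \<subseteq> ball 0 1"
    using f im kb by (auto simp: \<phi>_def image_subset_iff)
  have \<phi>_nofix: "\<phi> z \<noteq> z" if "norm z < 1" for z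
  proof
    assume "\<phi> z = z"
    have gz: "g z \<in> \<Omega>" using im that by auto
    then have "f (g z) \<in> \<Omega>" using f by blast
    then have "f (g z) = g z" using gk[of "f (g z)"] \<open>\<phi> z = z\<close> by (simp add: \<phi>_def)
    then show False using f gz by blast
  qed
  obtain x where x: "norm x = 1"
    and horo: "\<And>K. compact K \<Longrightarrow> K \<subseteq> ball 0 1 \<Longrightarrow> \<exists>R. \<forall>n. \<forall>z\<in>K. (\<phi> ^^ n) z \<in> horodisc x R"
    and unif: "\<And>K. compact K \<Longrightarrow> K \<subseteq> ball 0 1 \<Longrightarrow> uniform_limit K (\<lambda>n. \<phi> ^^ n) (\<lambda>_. x) sequentially"
    using Denjoy_Wolff[OF \<phi>_hol \<phi>_maps \<phi>_nofix] by metis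
  have orbit: "(\<phi> ^^ n) z \<in> ball 0 1" if "z \<in> ball 0 1" for n z
    using holomorphic_on_funpow_ball[OF \<phi>_hol \<phi>_maps, of n] that by blast
  have conj: "(f ^^ n) y \<in> \<Omega> \<and> k ((f ^^ n) y) = (\<phi> ^^ n) (k y)" if "y \<in> \<Omega>" for n y
  proof (induction n)
    case (Suc n)
    then have "g ((\<phi> ^^ n) (k y)) = (f ^^ n) y" using gk[of "(f ^^ n) y"] by simp
    then have "k ((f ^^ Suc n) y) = \<phi> ((\<phi> ^^ n) (k y))" by (simp add: \<phi>_def)
    then show ?case using Suc f by auto
  qed (use that in simp)
  have iter: "(f ^^ n) y = g ((\<phi> ^^ n) (k y))" if "y \<in> \<Omega>" for n y
    using conj[OF that, of n] gk[of "(f ^^ n) y"] by simp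
  have key: "\<exists>a. \<forall>K. compact K \<and> K \<subseteq> ball 0 1 \<longrightarrow> uniform_limit K (\<lambda>n z. g ((\<phi> ^^ n) z)) (\<lambda>_. a) sequentially"
  proof -
    obtain R0 where R0: "(\<phi> ^^ n) 0 \<in> horodisc x R0" for n using horo[of "{0}"] by auto
    obtain a where a: "(g \<longlongrightarrow> a) (at x within horodisc x R0 \<inter> ball 0 1)" using lim[OF x] by blast
    have "uniform_limit K (\<lambda>n z. g ((\<phi> ^^ n) z)) (\<lambda>_. a) sequentially"
      if K: "compact K" "K \<subseteq> ball 0 1" for K
    proof -
      \<comment> \<open>Adding 0 puts one common orbit into both horodiscs; along it the limits
        \<open>a\<close> and \<open>b\<close> must agree.\<close>
      have K0: "compact (insert 0 K)" "insert 0 K \<subseteq> ball 0 1" using K by auto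
      obtain R1 where R1: "\<And>n z. z \<in> insert 0 K \<Longrightarrow> (\<phi> ^^ n) z \<in> horodisc x R1" using horo[OF K0] by blast
      obtain b where b: "(g \<longlongrightarrow> b) (at x within horodisc x R1 \<inter> ball 0 1)" using lim[OF x] by blast
      have unif_b: "uniform_limit (insert 0 K) (\<lambda>n z. g ((\<phi> ^^ n) z)) (\<lambda>_. b) sequentially"
      proof (rule uniform_limitI)
        fix e :: real assume "e > 0"
        then obtain d where d: "d > 0"
          "\<And>y. y \<in> horodisc x R1 \<inter> ball 0 1 \<Longrightarrow> y \<noteq> x \<Longrightarrow> dist y x < d \<Longrightarrow> dist (g y) b < e"
          using b unfolding Lim_within by (metis zero_less_dist_iff)
        have "\<forall>\<^sub>F n in sequentially. \<forall>z\<in>insert 0 K. dist ((\<phi> ^^ n) z) x < d"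
          using unif[OF K0] d(1) by (rule uniform_limitD)
        then show "\<forall>\<^sub>F n in sequentially. \<forall>z\<in>insert 0 K. dist (g ((\<phi> ^^ n) z)) b < e"
        proof eventually_elim
          case (elim n)
          show ?case
          proof
            fix z assume z: "z \<in> insert 0 K"
            then have "(\<phi> ^^ n) z \<in> ball 0 1" using orbit K0(2) by blast
            moreover from this have "(\<phi> ^^ n) z \<noteq> x" using x by auto
            ultimately show "dist (g ((\<phi> ^^ n) z)) b < e" using d(2) R1[OF z] elim z by blast
          qed
        qed
      qed
      have \<phi>0: "(\<lambda>n. (\<phi> ^^ n) 0) \<longlonglongrightarrow> x"
        using tendsto_uniform_limitI[OF unif[OF K0], of 0] by simp
      have "(\<phi> ^^ n) 0 \<in> horodisc x R0 \<inter> ball 0 1 \<and> (\<phi> ^^ n) 0 \<noteq> x" for n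
        using R0[of n] orbit[of 0 n] x by auto
      then have "filterlim (\<lambda>n. (\<phi> ^^ n) 0) (at x within horodisc x R0 \<inter> ball 0 1) sequentially"
        unfolding filterlim_at using \<phi>0 by simp
      from filterlim_compose[OF a this] have "(\<lambda>n. g ((\<phi> ^^ n) 0)) \<longlonglongrightarrow> a" .
      moreover have "(\<lambda>n. g ((\<phi> ^^ n) 0)) \<longlonglongrightarrow> b"
        using tendsto_uniform_limitI[OF unif_b, of 0] by simp
      ultimately have "a = b" by (rule LIMSEQ_unique)
      then show ?thesis using unif_b by (auto intro: uniform_limit_on_subset)
    qed
    then show ?thesis by blast
  qed
  then obtain a where a: "\<And>K. compact K \<Longrightarrow> K \<subseteq> ball 0 1 \<Longrightarrow>
      uniform_limit K (\<lambda>n z. g ((\<phi> ^^ n) z)) (\<lambda>_. a) sequentially" by blast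
  have unif_f: "uniform_limit K (\<lambda>n. f ^^ n) (\<lambda>_. a) sequentially" if K: "compact K" "K \<subseteq> \<Omega>" for K
  proof -
    have "compact (k ` K)"
      using k(1) K holomorphic_on_imp_continuous_on holomorphic_on_subset
      by (blast intro: compact_continuous_image)
    moreover have "k ` K \<subseteq> ball 0 1" using kb K(2) by blast
    ultimately have u: "uniform_limit (k ` K) (\<lambda>n z. g ((\<phi> ^^ n) z)) (\<lambda>_. a) sequentially" by (rule a)
    show ?thesis
    proof (rule uniform_limitI)
      fix e :: real assume "e > 0"
      from uniform_limitD[OF u this]
      show "\<forall>\<^sub>F n in sequentially. \<forall>y\<in>K. dist ((f ^^ n) y) a < e"
        by eventually_elim (use iter K(2) in auto)
    qed
  qed
  have "a \<notin> \<Omega>"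
  proof (rule biholomorphism_boundary_value[OF hol open_ball bij])
    show "(\<phi> ^^ n) 0 \<in> ball 0 1" for n by (rule orbit) simp
    show "(\<lambda>n. (\<phi> ^^ n) 0) \<longlonglongrightarrow> x" using tendsto_uniform_limitI[OF unif[of "{0}"], of 0] by simp
    show "(\<lambda>n. g ((\<phi> ^^ n) 0)) \<longlonglongrightarrow> a" using tendsto_uniform_limitI[OF a[of "{0}"], of 0] by simp
  qed (use x in simp)
  moreover have "g ((\<phi> ^^ n) 0) \<in> \<Omega>" for n using orbit[of 0 n] im by force
  ultimately have "to_sphere a \<in> sphere_boundary \<Omega>"
    using tendsto_uniform_limitI[OF a[of "{0}"], of 0]
    by (intro to_sphere_limit_in_sphere_boundary[of "\<lambda>n. g ((\<phi> ^^ n) 0)"]) auto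
  moreover have "uniform_limit K (\<lambda>n z. to_sphere ((f ^^ n) z)) (\<lambda>_. to_sphere a) sequentially"
    if "compact K" "K \<subseteq> \<Omega>" for K
  proof (rule uniform_limitI)
    fix e :: real assume "e > 0"
    then obtain d where d: "d > 0" "\<And>y. dist y a < d \<Longrightarrow> dist (to_sphere y) (to_sphere a) < e"
      using isCont_to_sphere[of a] unfolding continuous_at_eps_delta by (metis dist_norm)
    from uniform_limitD[OF unif_f[OF that] d(1)]
    show "\<forall>\<^sub>F n in sequentially. \<forall>z\<in>K. dist (to_sphere ((f ^^ n) z)) (to_sphere a) < e"
      by eventually_elim (use d(2) in blast)
  qed
  ultimately show "\<exists>\<tau>\<in>sphere_boundary \<Omega>. \<forall>K. compact K \<and> K \<subseteq> \<Omega> \<longrightarrow>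
      uniform_limit K (\<lambda>n z. to_sphere ((f ^^ n) z)) (\<lambda>_. \<tau>) sequentially" by (intro bexI[of _ "to_sphere a"]) auto
qed

section \<open>A map with peaks accumulating at one boundary point\<close>

lemma norm_Ln_le_add_pi:
  assumes "w \<noteq> 0" "exp (- L) \<le> norm w" "norm w \<le> exp L"
  shows "norm (Ln w) \<le> L + pi"
proof -
  have "ln (norm w) \<le> ln (exp L)" "ln (exp (- L)) \<le> ln (norm w)"
    using assms by (subst ln_le_cancel_iff; simp)+
  then have "\<bar>ln (norm w)\<bar> \<le> L" by simp
  moreover have "\<bar>Im (Ln w)\<bar> \<le> pi"
    using mpi_less_Im_Ln[OF assms(1)] Im_Ln_le_pi[OF assms(1)] by simp
  ultimately show ?thesis
    using cmod_le[of "Ln w"] assms(1) by simp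
qed

definition gap :: "nat \<Rightarrow> real" where
  "gap k = (1 / 2) ^ Suc k"

text \<open>Bounds the k-th term where |1 - c_k z| is at least \<open>d * (gap k)\<^sup>2\<close>:
  there the modulus of the logarithm's real part is at most ln (1/d) + 2k + 3. The remaining 4
  exceeds pi and covers the argument; the factor 2 comes from |c_k| being at least 1/2.\<close>

definition majorant :: "real \<Rightarrow> nat \<Rightarrow> real" where
  "majorant d k = 2 * gap k * (ln (1 / d) + 2 * real k + 7)"

text \<open>The value 1/8 belongs to the threshold \<open>gap k / 8\<close> for |1 - c_k z| that
  delimits the k-th peak.\<close>

definition majorant_total :: real where
  "majorant_total = suminf (majorant (1 / 8))"

text \<open>The factor 2 lets a peak dominate all other terms together, at the peak and elsewhere; the
  constant 9 gives \<open>depth k < gap k / 8\<close> below.\<close>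
definition peak :: real where
  "peak = 2 * majorant_total + 9"

text \<open>The solution of \<open>gap k * ln (1 / depth k) = peak\<close>.\<close>

definition depth :: "nat \<Rightarrow> real" where
  "depth k = exp (- peak / gap k)"

text \<open>The real part is fixed by |c_k|^2 = 1 - \<open>depth k\<close>.\<close>

definition centre :: "nat \<Rightarrow> complex" where
  "centre k = Complex (sqrt (1 - depth k - (gap k)\<^sup>2)) (gap k)"

text \<open>The primitive of gap / (1 - c_k z) that vanishes at 0. Its pole 1 / c_k lies just
  outside the closed disc.\<close>

definition summand :: "nat \<Rightarrow> complex \<Rightarrow> complex" where
  "summand k z = - (of_real (gap k) / centre k) * Ln (1 - centre k * z)"

definition peaked_map :: "complex \<Rightarrow> complex" where
  "peaked_map z = (\<Sum>k. summand k z)"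

lemma gap: "0 < gap k" "gap k \<le> 1 / 2" "(gap k)\<^sup>2 \<le> gap k"
proof -
  show 1: "0 < gap k" by (simp add: gap_def)
  have "(1 / 2) ^ k \<le> (1 :: real)" by (rule power_le_one) auto
  then show 2: "gap k \<le> 1 / 2" by (simp add: gap_def)
  show "(gap k)\<^sup>2 \<le> gap k" using 1 2 by (simp add: power2_eq_square mult_left_le)
qed

lemma gap_antimono: "j < k \<Longrightarrow> gap k \<le> gap j / 2"
proof -
  assume "j < k"
  then have "(1 / 2 :: real) ^ Suc k \<le> (1 / 2) ^ Suc (Suc j)"
    by (intro power_decreasing) auto
  then show ?thesis by (simp add: gap_def)
qed

lemma gap_tendsto_0: "gap \<longlonglongrightarrow> 0"
  unfolding gap_def[abs_def] by (intro LIMSEQ_Suc LIMSEQ_power_zero) auto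

lemma summable_majorant: "summable (majorant d)"
proof -
  have "summable (\<lambda>k. (ln (1 / d) + 5) * (1 / 2) ^ k + 2 * (of_nat (Suc k) * (1 / 2) ^ k))"
    by (intro summable_add summable_mult sums_summable[OF geometric_deriv_sums]) auto
  moreover have "majorant d = (\<lambda>k. (ln (1 / d) + 5) * (1 / 2) ^ k + 2 * (of_nat (Suc k) * (1 / 2) ^ k))"
    by (simp add: fun_eq_iff majorant_def gap_def algebra_simps)
  ultimately show ?thesis by simp
qed

lemma majorant_nonneg: "0 < d \<Longrightarrow> d \<le> 1 \<Longrightarrow> 0 \<le> majorant d k"
  using gap(1)[of k] by (simp add: majorant_def)

lemma majorant_total_nonneg: "0 \<le> majorant_total"
  unfolding majorant_total_def by (intro suminf_nonneg summable_majorant majorant_nonneg) auto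

lemma depth: "0 < depth k" "depth k < gap k / 8"
proof -
  show "0 < depth k" by (simp add: depth_def)
  have "peak / gap k < exp (peak / gap k)"
    using exp_ge_add_one_self[of "peak / gap k"] by linarith
  then have "depth k < inverse (peak / gap k)"
    unfolding depth_def minus_divide_left[symmetric] exp_minus
    using gap(1)[of k] majorant_total_nonneg by (intro less_imp_inverse_less) (auto simp: peak_def)
  also have "\<dots> = gap k / peak" by simp
  also have "\<dots> \<le> gap k / 9"
    using gap(1)[of k] majorant_total_nonneg by (intro divide_left_mono) (auto simp: peak_def)
  also have "\<dots> < gap k / 8" using gap(1)[of k] by simp
  finally show "depth k < gap k / 8" .
qed

lemma Im_centre [simp]: "Im (centre k) = gap k"
  by (simp add: centre_def)

lemma centre:
  shows norm_centre_square: "(norm (centre k))\<^sup>2 = 1 - depth k"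
    and norm_centre_less: "norm (centre k) < 1"
    and norm_centre_ge: "1 / 2 \<le> norm (centre k)"
    and one_minus_norm_centre: "depth k / 2 \<le> 1 - norm (centre k)"
proof -
  have "depth k + (gap k)\<^sup>2 \<le> 5 / 8"
    using depth(2)[of k] gap[of k] by linarith
  then show sq: "(norm (centre k))\<^sup>2 = 1 - depth k"
    by (simp add: cmod_power2 centre_def)
  show lt: "norm (centre k) < 1"
    using sq depth(1)[of k] by (intro power2_less_imp_less[of _ 1]) auto
  have "(1 / 2)\<^sup>2 \<le> (norm (centre k))\<^sup>2"
    unfolding sq using depth(2)[of k] gap(2)[of k] by (simp add: power2_eq_square)
  then show "1 / 2 \<le> norm (centre k)" by (rule power2_le_imp_le) simp
  have "depth k = (1 - norm (centre k)) * (1 + norm (centre k))"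
    using sq by (simp add: power2_eq_square algebra_simps)
  also have "\<dots> \<le> (1 - norm (centre k)) * 2"
    using lt by (intro mult_left_mono) auto
  finally show "depth k / 2 \<le> 1 - norm (centre k)" by simp
qed

lemma centre_nonzero [simp]: "centre k \<noteq> 0"
  using norm_centre_ge[of k] by auto

lemma centre_tendsto_1: "centre \<longlonglongrightarrow> 1"
proof -
  have "depth \<longlonglongrightarrow> 0"
  proof (rule tendsto_sandwich)
    have "0 \<le> depth k \<and> depth k \<le> gap k" for k using depth[of k] gap(1)[of k] by linarith
    then show "\<forall>\<^sub>F k in sequentially. 0 \<le> depth k" "\<forall>\<^sub>F k in sequentially. depth k \<le> gap k"
      by (auto intro!: always_eventually)
  qed (use gap_tendsto_0 in auto)
  then have "(\<lambda>k. Complex (sqrt (1 - depth k - (gap k)\<^sup>2)) (gap k)) \<longlonglongrightarrow> Complex (sqrt (1 - 0 - 0\<^sup>2)) 0"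
    by (intro tendsto_intros gap_tendsto_0)
  then show ?thesis by (simp add: centre_def[abs_def] one_complex.code)
qed

lemma norm_centre_mult:
  assumes "norm z \<le> 1"
  shows "norm (centre k * z) \<le> norm (centre k)" "norm (centre k * z) < 1" "norm (1 - centre k * z) \<le> 2"
    "1 - norm z \<le> norm (1 - centre k * z)" "1 - norm (centre k) \<le> norm (1 - centre k * z)"
    "1 - centre k * z \<noteq> 0"
proof -
  show 1: "norm (centre k * z) \<le> norm (centre k)"
    using assms by (simp add: norm_mult mult_left_le)
  then show 2: "norm (centre k * z) < 1" using norm_centre_less[of k] by linarith
  then show "norm (1 - centre k * z) \<le> 2"
    using norm_triangle_ineq4[of 1 "centre k * z"] by simp
  have "norm (centre k * z) \<le> norm z"
    using norm_centre_less[of k] by (simp add: norm_mult mult_left_le_one_le)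
  then show "1 - norm z \<le> norm (1 - centre k * z)"
    using norm_triangle_ineq2[of 1 "centre k * z"] by simp
  show 3: "1 - norm (centre k) \<le> norm (1 - centre k * z)"
    using norm_triangle_ineq2[of 1 "centre k * z"] 1 by simp
  show "1 - centre k * z \<noteq> 0" using 3 norm_centre_less[of k] by auto
qed

section \<open>Size of the single terms and convergence of the series\<close>

lemma norm_summand_le_Ln:
  assumes "norm z \<le> 1" "exp (- L) \<le> norm (1 - centre k * z)" "1 \<le> L"
  shows "norm (summand k z) \<le> 2 * gap k * (L + 4)"
proof -
  have "norm (1 - centre k * z) \<le> exp L"
    using norm_centre_mult(3)[OF assms(1), of k] exp_ge_add_one_self[of L] assms(3) by linarith
  then have "norm (Ln (1 - centre k * z)) \<le> L + pi"
    using norm_centre_mult(6)[OF assms(1)] assms(2) by (intro norm_Ln_le_add_pi)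
  also have "\<dots> \<le> L + 4" using pi_less_4 by simp
  finally have Ln: "norm (Ln (1 - centre k * z)) \<le> L + 4" .
  have "gap k / norm (centre k) \<le> gap k / (1 / 2)"
    using gap(1)[of k] norm_centre_ge[of k] by (intro divide_left_mono) auto
  then have "gap k / norm (centre k) * norm (Ln (1 - centre k * z)) \<le> 2 * gap k * (L + 4)"
    using Ln gap(1)[of k] by (intro mult_mono) auto
  then show ?thesis using gap(1)[of k] by (simp add: summand_def norm_mult norm_divide)
qed

lemma norm_summand_le_majorant:
  assumes z: "norm z \<le> 1" and d: "0 < d" "d \<le> 1" "d * (gap k)\<^sup>2 \<le> norm (1 - centre k * z)"
  shows "norm (summand k z) \<le> majorant d k"
proof -
  define L where "L = ln (1 / d) + 2 * real k + 3"
  have L: "1 \<le> L" using d by (simp add: L_def)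
  have "inverse (exp (1::real)) \<le> 1 / 2"
    using exp_ge_add_one_self[of "1::real"] by (simp add: field_simps)
  then have "exp (- 1 :: real) ^ (2 * Suc k) \<le> (1 / 2) ^ (2 * Suc k)"
    by (intro power_mono) (auto simp: exp_minus)
  also have "\<dots> = (gap k)\<^sup>2" by (simp only: gap_def power_mult[symmetric] mult.commute)
  finally have "exp (- (2 * real k + 2)) \<le> (gap k)\<^sup>2"
    by (simp only: exp_of_nat_mult[symmetric]) (simp add: algebra_simps)
  moreover have "exp (- (2 * real k + 3)) \<le> exp (- (2 * real k + 2))" by simp
  ultimately have "exp (- (2 * real k + 3)) \<le> (gap k)\<^sup>2" by linarith
  then have "d * exp (- (2 * real k + 3)) \<le> d * (gap k)\<^sup>2" using d by simp
  moreover have "exp (- L) = d * exp (- (2 * real k + 3))"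
    using d by (simp add: L_def exp_diff exp_add exp_minus ln_div field_simps)
  ultimately have "exp (- L) \<le> norm (1 - centre k * z)" using d by linarith
  from norm_summand_le_Ln[OF z this L] show ?thesis
    by (simp add: majorant_def L_def algebra_simps)
qed

text \<open>Even at its own peak |1 - c_k z| is at least \<open>depth k / 2\<close>. The logarithm
  is then of order \<open>peak / gap k\<close>, and the weight \<open>gap k\<close> cancels the
  denominator.\<close>

lemma norm_summand_le:
  assumes z: "norm z \<le> 1"
  shows "norm (summand k z) \<le> 2 * peak + 5"
proof -
  \<comment> \<open>The additional 1 absorbs the halving of \<open>depth k\<close>, as 1/e is at
    most 1/2.\<close>
  define L where "L = peak / gap k + 1"
  have "inverse (exp (1::real)) \<le> 1 / 2"
    using exp_ge_add_one_self[of "1::real"] by (simp add: field_simps)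
  then have "exp (- L) \<le> depth k / 2"
    using depth(1)[of k] by (simp add: L_def depth_def exp_diff exp_minus field_simps)
  also have "\<dots> \<le> norm (1 - centre k * z)"
    using one_minus_norm_centre[of k] norm_centre_mult(5)[OF z, of k] by linarith
  finally have "exp (- L) \<le> norm (1 - centre k * z)" .
  moreover have "1 \<le> L" using gap(1)[of k] majorant_total_nonneg by (simp add: L_def peak_def)
  ultimately have "norm (summand k z) \<le> 2 * gap k * (L + 4)"
    by (rule norm_summand_le_Ln[OF z])
  also have "\<dots> = 2 * peak + 10 * gap k" using gap(1)[of k] by (simp add: L_def field_simps)
  also have "\<dots> \<le> 2 * peak + 5" using gap(2)[of k] by simp
  finally show ?thesis .
qed

lemma summand_DERIV:
  assumes "norm z \<le> 1"
  shows "(summand k has_field_derivative of_real (gap k) / (1 - centre k * z)) (at z)"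
proof -
  have "0 < Re (1 - centre k * z)"
    using norm_centre_mult(2)[OF assms, of k] complex_Re_le_cmod[of "centre k * z"] by simp
  then have "1 - centre k * z \<notin> \<real>\<^sub>\<le>\<^sub>0" by (auto simp: complex_nonpos_Reals_iff)
  then show ?thesis
    unfolding summand_def
    using norm_centre_mult(6)[OF assms, of k]
    by (auto intro!: derivative_eq_intros simp: field_simps)
qed

lemma continuous_on_summand: "continuous_on (cball 0 1) (summand k)"
proof (intro continuous_at_imp_continuous_on ballI)
  fix z :: complex assume "z \<in> cball 0 1"
  then show "isCont (summand k) z" by (intro DERIV_isCont[OF summand_DERIV]) simp
qed

lemma holomorphic_on_summand: "summand k holomorphic_on ball 0 1"
  unfolding holomorphic_on_open[OF open_ball] using summand_DERIV by (metis less_imp_le mem_ball_0)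

text \<open>The common criterion for compact discs, horodiscs at 1 and neighbourhoods of the other
  boundary points. The lower bound may shrink like \<open>(gap k)\<^sup>2\<close>, which costs only
  a factor of order k in the k-th term.\<close>

lemma uniform_limit_peaked_map:
  assumes S: "S \<subseteq> cball 0 1" and "0 < d"
    and d: "\<And>k z. z \<in> S \<Longrightarrow> d * (gap k)\<^sup>2 \<le> norm (1 - centre k * z)"
  shows "uniform_limit S (\<lambda>n z. \<Sum>k<n. summand k z) peaked_map sequentially"
    and "z \<in> S \<Longrightarrow> summable (\<lambda>k. summand k z)"
proof -
  have le: "norm (summand k z) \<le> majorant (min d 1) k" if "z \<in> S" for k z
  proof (rule norm_summand_le_majorant)
    have "min d 1 * (gap k)\<^sup>2 \<le> d * (gap k)\<^sup>2" by (intro mult_right_mono) auto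
    then show "min d 1 * (gap k)\<^sup>2 \<le> norm (1 - centre k * z)" using d[OF that, of k] by linarith
  qed (use S that \<open>0 < d\<close> in auto)
  show "uniform_limit S (\<lambda>n z. \<Sum>k<n. summand k z) peaked_map sequentially"
    unfolding peaked_map_def[abs_def]
    using le by (rule Weierstrass_m_test[OF _ summable_majorant])
  show "summable (\<lambda>k. summand k z)" if "z \<in> S"
    using le[OF that] by (intro summable_comparison_test'[OF summable_majorant[of "min d 1"], of 0]) auto
qed

lemma continuous_on_peaked_map:
  assumes S: "S \<subseteq> cball 0 1" and "0 < d"
    and d: "\<And>k z. z \<in> S \<Longrightarrow> d * (gap k)\<^sup>2 \<le> norm (1 - centre k * z)"
  shows "continuous_on S peaked_map"
proof (rule uniform_limit_theorem[OF _ uniform_limit_peaked_map(1)[OF assms]])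
  show "\<forall>\<^sub>F n in sequentially. continuous_on S (\<lambda>z. \<Sum>k<n. summand k z)"
    using continuous_on_subset[OF continuous_on_summand S] by (intro always_eventually allI continuous_on_sum)
qed auto

lemma cball_lower_bound:
  assumes "r < 1" "norm z \<le> r"
  shows "(1 - r) * (gap k)\<^sup>2 \<le> norm (1 - centre k * z)"
proof -
  have "(1 - r) * (gap k)\<^sup>2 \<le> (1 - r) * 1"
    using assms gap[of k] by (intro mult_left_mono) auto
  also have "\<dots> \<le> norm (1 - centre k * z)"
    using assms norm_centre_mult(4)[of z k] by simp
  finally show ?thesis .
qed

lemma holomorphic_on_peaked_map: "peaked_map holomorphic_on ball 0 1"
proof (rule holomorphic_uniform_sequence[OF open_ball])
  show "(\<lambda>z. \<Sum>k<n. summand k z) holomorphic_on ball 0 1" for n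
    by (intro holomorphic_on_sum holomorphic_on_summand)
  fix x :: complex assume x: "x \<in> ball 0 1"
  define e where "e = (1 - norm x) / 2"
  have e: "0 < e" "norm x + e < 1" using x by (auto simp: e_def field_simps)
  have le: "norm z \<le> norm x + e" if "z \<in> cball x e" for z
    using that norm_triangle_sub[of z x] by (simp add: dist_norm norm_minus_commute)
  have sub: "cball x e \<subseteq> ball 0 1" using le e(2) by fastforce
  have "uniform_limit (cball x e) (\<lambda>n z. \<Sum>k<n. summand k z) peaked_map sequentially"
    using le e(2) sub
    by (intro uniform_limit_peaked_map(1)[of _ "1 - (norm x + e)"] cball_lower_bound) auto
  then show "\<exists>d>0. cball x d \<subseteq> ball 0 1 \<and>
      uniform_limit (cball x d) (\<lambda>n z. \<Sum>k<n. summand k z) peaked_map sequentially"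
    using e(1) sub by (intro exI[of _ e]) simp
qed

lemma summable_summand: "norm z < 1 \<Longrightarrow> summable (\<lambda>k. summand k z)"
  using cball_lower_bound[of "norm z" z]
  by (intro uniform_limit_peaked_map(2)[of "{z}" "1 - norm z"]) auto

text \<open>Each summand has a derivative of positive real part on the convex disc, hence difference
  quotients of positive real part, and this survives summation (Noshiro and Warschawski).\<close>
lemma Re_difference_quotient_pos:
  fixes f :: "complex \<Rightarrow> complex"
  assumes "convex S" "a \<in> S" "b \<in> S" "a \<noteq> b"
    and f: "\<And>z. z \<in> S \<Longrightarrow> (f has_field_derivative f' z) (at z)"
    and pos: "\<And>z. z \<in> S \<Longrightarrow> 0 < Re (f' z)"
  shows "0 < Re ((f b - f a) / (b - a))"
proof -
  define l where "l s = a + of_real s * (b - a)" for s :: real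
  have l: "l s \<in> S" if "0 \<le> s" "s \<le> 1" for s
  proof -
    have "l s = (1 - s) *\<^sub>R a + s *\<^sub>R b" by (simp add: l_def scaleR_conv_of_real algebra_simps)
    then show ?thesis using assms(1-3) that by (simp add: convex_alt)
  qed
  define p where "p s = Re (f (l s) / (b - a))" for s
  have p: "(p has_real_derivative Re (f' (l s))) (at s)" if "0 \<le> s" "s \<le> 1" for s
  proof -
    have "(l has_vector_derivative (b - a)) (at s)"
      unfolding l_def by (auto intro!: derivative_eq_intros simp: has_vector_derivative_def
          scaleR_conv_of_real)
    from field_vector_diff_chain_at[OF this f[OF l[OF that]]]
    have "((f \<circ> l) has_vector_derivative (b - a) * f' (l s)) (at s)" .
    then have "((\<lambda>s. f (l s) / (b - a)) has_vector_derivative (b - a) * f' (l s) / (b - a)) (at s)"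
      by (intro has_vector_derivative_divide) (simp add: comp_def)
    then have "((\<lambda>s. f (l s) / (b - a)) has_vector_derivative f' (l s)) (at s)"
      using assms(4) by simp
    then show ?thesis
      unfolding p_def has_real_derivative_iff_has_vector_derivative
      by (rule bounded_linear.has_vector_derivative[OF bounded_linear_Re])
  qed
  have "p 0 < p 1"
    using p pos l by (intro DERIV_pos_imp_increasing[of 0 1 p]) (auto intro!: exI)
  then show ?thesis by (simp add: p_def l_def diff_divide_distrib)
qed

lemma inj_on_peaked_map: "inj_on peaked_map (ball 0 1)"
proof (rule inj_onI, rule ccontr)
  fix a b assume a: "a \<in> ball 0 1" and b: "b \<in> ball 0 1" and eq: "peaked_map a = peaked_map b" and "a \<noteq> b"
  have pos: "0 < Re ((summand k b - summand k a) / (b - a))" for k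
  proof (rule Re_difference_quotient_pos[OF convex_ball a b \<open>a \<noteq> b\<close>])
    fix z :: complex assume z: "z \<in> ball 0 1"
    then show "(summand k has_field_derivative of_real (gap k) / (1 - centre k * z)) (at z)"
      by (intro summand_DERIV) simp
    have "0 < Re (1 - centre k * z)"
      using norm_centre_mult(2)[of z k] z complex_Re_le_cmod[of "centre k * z"] by simp
    then show "0 < Re (of_real (gap k) / (1 - centre k * z))"
      using gap(1)[of k] norm_centre_mult(6)[of z k] z
      by (simp add: Re_divide cmod_power2[symmetric] del: minus_complex.simps)
  qed
  have sums: "(\<lambda>k. Re ((summand k b - summand k a) / (b - a))) sums Re ((peaked_map b - peaked_map a) / (b - a))"
    unfolding peaked_map_def using a b
    by (intro sums_Re sums_divide sums_diff summable_sums summable_summand) auto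
  have "0 < Re ((peaked_map b - peaked_map a) / (b - a))"
    using suminf_pos[OF sums_summable[OF sums] pos] sums_unique[OF sums] by simp
  then show False using eq by simp
qed

section \<open>Separation of the peaks, and upper and lower bounds for the map\<close>

text \<open>If j < k, two small values would force |c_j - c_k| < (gap j + gap k) / 8, but the
  imaginary parts already differ by at least gap j / 2.\<close>

lemma peak_unique:
  assumes z: "norm z \<le> 1" and "norm (1 - centre j * z) < gap j / 8" "norm (1 - centre k * z) < gap k / 8"
  shows "j = k"
proof -
  have *: False if jk: "j < k" and bad: "norm (1 - centre j * z) < gap j / 8" "norm (1 - centre k * z) < gap k / 8" for j k
  proof -
    have "gap j - gap k \<le> norm (centre j - centre k)"
      using abs_Im_le_cmod[of "centre j - centre k"] by simp
    also have "centre j - centre k = centre j * (1 - centre k * z) - centre k * (1 - centre j * z)"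
      by (simp add: algebra_simps)
    also have "norm \<dots> \<le> norm (1 - centre k * z) + norm (1 - centre j * z)"
    proof (rule norm_triangle_le_diff)
      show "norm (centre j * (1 - centre k * z)) + norm (centre k * (1 - centre j * z))
          \<le> norm (1 - centre k * z) + norm (1 - centre j * z)"
        using norm_centre_less[of j] norm_centre_less[of k]
        by (intro add_mono) (auto simp: norm_mult intro!: mult_left_le_one_le)
    qed
    finally show False using bad gap_antimono[OF jk] gap(1)[of j] by linarith
  qed
  show ?thesis using *[of j k] *[of k j] assms(2,3) by (meson linorder_neqE_nat)
qed

lemma norm_summand_le_off_peak:
  assumes "norm z \<le> 1" "gap k / 8 \<le> norm (1 - centre k * z)"
  shows "norm (summand k z) \<le> majorant (1 / 8) k"
  using assms gap(3)[of k] by (intro norm_summand_le_majorant) auto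

lemma norm_peaked_map_le_majorant_total:
  assumes "norm z \<le> 1" "\<And>k. gap k / 8 \<le> norm (1 - centre k * z)"
  shows "norm (peaked_map z) \<le> majorant_total"
  unfolding peaked_map_def majorant_total_def
  by (intro norm_suminf_le norm_summand_le_off_peak assms summable_majorant)

lemma norm_peaked_map_minus_summand_le:
  assumes z: "norm z < 1" and bad: "norm (1 - centre j * z) < gap j / 8"
  shows "norm (peaked_map z - summand j z) \<le> majorant_total"
proof -
  have "(\<lambda>k. summand k z - (if k = j then summand k z else 0)) sums (peaked_map z - summand j z)"
    unfolding peaked_map_def
    by (intro sums_diff summable_sums summable_summand z sums_single)
  then have "peaked_map z - summand j z = (\<Sum>k. summand k z - (if k = j then summand k z else 0))"
    by (rule sums_unique)
  also have "norm \<dots> \<le> majorant_total"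
    unfolding majorant_total_def
  proof (rule norm_suminf_le[OF _ summable_majorant])
    show "norm (summand k z - (if k = j then summand k z else 0)) \<le> majorant (1 / 8) k" for k
    proof (cases "k = j")
      case True then show ?thesis by (simp add: majorant_nonneg)
    next
      case False
      then have "gap k / 8 \<le> norm (1 - centre k * z)"
        using peak_unique[of z j k] z bad by force
      then show ?thesis using False norm_summand_le_off_peak[of z k] z by simp
    qed
  qed
  finally show ?thesis .
qed

text \<open>At each point at most one term can exceed its majorant, and that one is bounded
  uniformly in its index.\<close>

lemma norm_peaked_map_le:
  assumes z: "norm z < 1"
  shows "norm (peaked_map z) \<le> majorant_total + 2 * peak + 5"
proof (cases "\<exists>j. norm (1 - centre j * z) < gap j / 8")
  case True
  then obtain j where "norm (1 - centre j * z) < gap j / 8" by blast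
  from norm_peaked_map_minus_summand_le[OF z this] show ?thesis
    using norm_summand_le[of z j] z norm_triangle_sub[of "peaked_map z" "summand j z"] by simp
next
  case False
  then have "norm (peaked_map z) \<le> majorant_total"
    using z by (intro norm_peaked_map_le_majorant_total) (auto simp: not_less)
  then show ?thesis using majorant_total_nonneg by (simp add: peak_def)
qed

text \<open>At the conjugate of c_k the argument of the k-th logarithm is exactly the real number
  \<open>depth k\<close>, so this term alone has modulus at least \<open>peak\<close>.\<close>

lemma norm_peaked_map_at_peak: "peak - majorant_total \<le> norm (peaked_map (cnj (centre k)))"
proof -
  let ?z = "cnj (centre k)"
  have z: "norm ?z < 1" using norm_centre_less by simp
  have 1: "1 - centre k * ?z = of_real (depth k)"
    using norm_centre_square[of k] by (simp add: complex_norm_square[symmetric] of_real_power[symmetric] del: of_real_power)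
  have "norm (1 - centre k * ?z) < gap k / 8" unfolding 1 using depth[of k] by simp
  from norm_peaked_map_minus_summand_le[OF z this]
  have "norm (summand k ?z) - majorant_total \<le> norm (peaked_map ?z)"
    using norm_triangle_sub[of "summand k ?z" "peaked_map ?z"] by (simp add: norm_minus_commute)
  moreover have "norm (summand k ?z) = gap k / norm (centre k) * (peak / gap k)"
  proof -
    have "Ln (of_real (depth k)) = of_real (- (peak / gap k))"
      using depth(1)[of k] by (simp only: Ln_of_real) (simp add: depth_def)
    then have "norm (Ln (of_real (depth k))) = \<bar>- (peak / gap k)\<bar>" by (simp only: norm_of_real)
    then show ?thesis
      unfolding summand_def 1 using gap(1)[of k] majorant_total_nonneg
      by (simp add: norm_mult norm_divide peak_def)
  qed
  then have "norm (summand k ?z) = peak / norm (centre k)"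
    using gap(1)[of k] by simp
  moreover have "peak / 1 \<le> peak / norm (centre k)"
    using norm_centre_less[of k] norm_centre_ge[of k] majorant_total_nonneg
    by (intro divide_left_mono) (auto simp: peak_def)
  ultimately show ?thesis by simp
qed

text \<open>For real y the imaginary part of 1 - c_k y is -y \<open>gap k\<close>, so the radius
  near 1 meets no peak.\<close>

lemma norm_peaked_map_real_le:
  assumes "1 / 2 \<le> y" "y < 1"
  shows "norm (peaked_map (of_real y)) \<le> majorant_total"
proof (rule norm_peaked_map_le_majorant_total)
  fix k
  have "gap k * (1 / 8) \<le> gap k * y" using assms gap(1)[of k] by (intro mult_left_mono) auto
  also have "\<dots> \<le> norm (1 - centre k * of_real y)"
    using abs_Im_le_cmod[of "1 - centre k * of_real y"] assms gap(1)[of k] by simp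
  finally show "gap k / 8 \<le> norm (1 - centre k * of_real y)" by simp
qed (use assms in auto)

text \<open>Near 1 the imaginary part of c_k keeps |1 - c_k z| above \<open>gap k / 2\<close>.
  Farther away the horodisc keeps z off the circle: 1 - |z| is at least |1 - z|^2 / (2 R), hence at
  least \<open>(gap k)\<^sup>2\<close> / (8 R).\<close>

lemma horodisc_1_lower_bound:
  assumes z: "norm z \<le> 1" "z \<in> horodisc 1 R" and R: "1 \<le> R"
  shows "1 / (8 * R) * (gap k)\<^sup>2 \<le> norm (1 - centre k * z)"
proof (cases "norm (1 - z) \<le> gap k / 2")
  case True
  have "gap k \<le> norm (1 - centre k)" using abs_Im_le_cmod[of "1 - centre k"] gap(1)[of k] by simp
  also have "1 - centre k = (1 - centre k * z) - centre k * (1 - z)" by (simp add: algebra_simps)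
  also have "norm \<dots> \<le> norm (1 - centre k * z) + norm (1 - z)"
  proof (rule norm_triangle_le_diff)
    show "norm (1 - centre k * z) + norm (centre k * (1 - z)) \<le> norm (1 - centre k * z) + norm (1 - z)"
      using norm_centre_less[of k] by (auto simp: norm_mult intro!: mult_left_le_one_le)
  qed
  finally have "gap k / 2 \<le> norm (1 - centre k * z)" using True by simp
  moreover have "1 / (8 * R) * (gap k)\<^sup>2 \<le> 1 / 2 * gap k"
    using R gap[of k] by (intro mult_mono) (auto simp: field_simps)
  ultimately show ?thesis by simp
next
  case False
  then have "(gap k / 2)\<^sup>2 \<le> (norm (1 - z))\<^sup>2" using gap(1)[of k] by (intro power_mono) auto
  also have "\<dots> \<le> R * (1 - (norm z)\<^sup>2)" using z(2) by (simp add: horodisc_def)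
  also have "\<dots> \<le> R * (2 * (1 - norm z))"
    using z(1) R by (intro mult_left_mono one_minus_norm_square_le) auto
  also have "\<dots> \<le> R * (2 * norm (1 - centre k * z))"
    using norm_centre_mult(4)[OF z(1)] R by (intro mult_left_mono) auto
  finally show ?thesis using R by (simp add: field_simps power2_eq_square)
qed

text \<open>The limit is the value of the series at \<open>x\<close> itself: it converges uniformly
  on the horodisc including its tangency point if x = 1, and on a neighbourhood of \<open>x\<close>
  in the closed disc otherwise.\<close>

lemma peaked_map_limit_horodisc:
  assumes x: "norm x = 1"
  shows "\<exists>a. (peaked_map \<longlongrightarrow> a) (at x within horodisc x R \<inter> ball 0 1)"
proof (cases "x = 1")
  case True
  define R' where "R' = max R 1"
  have "horodisc x R \<inter> ball 0 1 \<subseteq> horodisc 1 R'"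
  proof
    fix z assume z: "z \<in> horodisc x R \<inter> ball 0 1"
    then have "R * (1 - (norm z)\<^sup>2) \<le> R' * (1 - (norm z)\<^sup>2)"
      by (intro mult_right_mono) (auto simp: R'_def abs_square_le_1)
    then show "z \<in> horodisc 1 R'" using z True by (simp add: horodisc_def)
  qed
  moreover have "1 \<in> horodisc 1 R'" by (simp add: horodisc_def)
  ultimately have "continuous_on (insert x (horodisc x R \<inter> ball 0 1)) peaked_map"
    using True by (intro continuous_on_peaked_map[where d = "1 / (8 * R')"] horodisc_1_lower_bound)
      (auto simp: R'_def)
  then have "(peaked_map \<longlongrightarrow> peaked_map x) (at x within insert x (horodisc x R \<inter> ball 0 1))"
    by (auto simp: continuous_on_def)
  then show ?thesis by (blast intro: tendsto_within_subset)
next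
  case False
  \<comment> \<open>Of the distance 4 e from \<open>x\<close> to 1, at most 2 e is lost to |c_k - 1|
    and |z - x|, which leaves |1 - c_k z| above 2 e for k at least \<open>N\<close>.\<close>
  define e where "e = norm (1 - x) / 4"
  have e: "e > 0" using False by (simp add: e_def)
  obtain N where N: "\<And>k. k \<ge> N \<Longrightarrow> norm (centre k - 1) < e"
    using LIMSEQ_D[OF centre_tendsto_1 e] by blast
  \<comment> \<open>The finitely many earlier terms are handled by their distance 1 - |c_k| from the
    circle.\<close>
  define d where "d = Min (insert e ((\<lambda>k. 1 - norm (centre k)) ` {..<N}))"
  have d: "d > 0" "d \<le> e" "\<And>k. k < N \<Longrightarrow> d \<le> 1 - norm (centre k)"
    using e norm_centre_less by (auto simp: d_def)
  have "continuous_on (cball 0 1 \<inter> ball x e) peaked_map"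
  proof (rule continuous_on_peaked_map[OF _ d(1)])
    fix k z assume z: "z \<in> cball 0 1 \<inter> ball x e"
    have "d * (gap k)\<^sup>2 \<le> d * 1" using gap[of k] d(1) by (intro mult_left_mono) auto
    also have "\<dots> \<le> norm (1 - centre k * z)"
    proof (cases "k < N")
      case True
      then show ?thesis using d(3) norm_centre_mult(5)[of z k] z by fastforce
    next
      case False
      have "1 - x = (1 - centre k * z) + ((centre k - 1) * z + (z - x))" by (simp add: algebra_simps)
      then have "norm (1 - x) \<le> norm (1 - centre k * z) + (norm (centre k - 1) * norm z + norm (z - x))"
        by (metis norm_add_rule_thm norm_mult norm_triangle_mono order_refl)
      moreover have "norm (centre k - 1) * norm z \<le> norm (centre k - 1)"
        using z by (intro mult_right_le_one_le) auto
      moreover have "norm (z - x) < e" using z by (simp add: dist_norm norm_minus_commute)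
      moreover have "norm (centre k - 1) < e" using N[of k] False by simp
      ultimately show ?thesis using d(1,2) unfolding e_def by linarith
    qed
    finally show "d * (gap k)\<^sup>2 \<le> norm (1 - centre k * z)" .
  qed auto
  then have "(peaked_map \<longlongrightarrow> peaked_map x) (at x within (cball 0 1 \<inter> ball x e))"
    using x e by (auto simp: continuous_on_def)
  then have "(peaked_map \<longlongrightarrow> peaked_map x) (at x within (horodisc x R \<inter> ball 0 1 \<inter> ball x e))"
    by (rule tendsto_within_subset) auto
  moreover have "at x within (horodisc x R \<inter> ball 0 1 \<inter> ball x e) = at x within (horodisc x R \<inter> ball 0 1)"
    using e by (intro at_within_nhd[of x "ball x e"]) auto
  ultimately show ?thesis by auto
qed

theorem corollary1p6:
  "\<exists>\<Omega> :: complex set. open \<Omega> \<and> connected \<Omega> \<and> \<Omega> \<noteq> {} \<and> bounded \<Omega> \<and> simply_connected \<Omega> \<and>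
     denjoy_wolff_property \<Omega> \<and> \<not> visible_domain \<Omega>"
proof -
  define \<Omega> where "\<Omega> = peaked_map ` ball 0 1"
  note hol = holomorphic_on_peaked_map
  have bij: "bij_betw peaked_map (ball 0 1) \<Omega>"
    using inj_on_peaked_map by (simp add: \<Omega>_def bij_betw_def)
  have cont: "continuous_on (ball 0 1) peaked_map" by (rule holomorphic_on_imp_continuous_on[OF hol])
  have op: "open \<Omega>"
    unfolding \<Omega>_def by (rule open_mapping_thm3[OF hol open_ball inj_on_peaked_map])
  have conn: "connected \<Omega>" unfolding \<Omega>_def by (intro connected_continuous_image cont connected_ball)
  have bdd: "bounded \<Omega>"
    unfolding \<Omega>_def bounded_iff using norm_peaked_map_le
    by (intro exI[of _ "majorant_total + 2 * peak + 5"]) auto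
  have "ball (0::complex) 1 homeomorphic \<Omega>"
    unfolding \<Omega>_def
    by (rule invariance_of_domain_homeomorphic[OF open_ball cont _ inj_on_peaked_map]) simp
  then have sc: "simply_connected \<Omega>"
    using homeomorphic_simply_connected convex_imp_simply_connected[OF convex_ball] by blast
  have dw: "denjoy_wolff_property \<Omega>"
    by (rule horodisc_limits_imp_denjoy_wolff_property[OF hol bij peaked_map_limit_horodisc])
  have subseq: "\<exists>s l. strict_mono (s :: nat \<Rightarrow> nat) \<and> (\<lambda>n. peaked_map (u (s n))) \<longlonglongrightarrow> l"
    if "\<And>n. norm (u n) < 1" for u :: "nat \<Rightarrow> complex"
  proof -
    have "bounded (range (peaked_map \<circ> u))"
      by (rule bounded_subset[OF bdd]) (use that in \<open>auto simp: \<Omega>_def\<close>)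
    from bounded_imp_convergent_subsequence[OF this] show ?thesis
      by (force simp: comp_def)
  qed
  define y :: "nat \<Rightarrow> real" where "y n = 1 - 1 / (real n + 2)" for n
  have y: "1 / 2 \<le> y n" "y n < 1" for n by (auto simp: y_def field_simps)
  have "y \<longlonglongrightarrow> 1" unfolding y_def by real_asymp
  then have y_lim: "(\<lambda>n. complex_of_real (y n)) \<longlonglongrightarrow> 1" using tendsto_of_real by fastforce
  have c_lim: "(\<lambda>n. cnj (centre n)) \<longlonglongrightarrow> 1" using tendsto_cnj[OF centre_tendsto_1] by simp
  have y1: "norm (complex_of_real (y n)) < 1" for n using y[of n] by simp
  have c1: "norm (cnj (centre n)) < 1" for n using norm_centre_less by simp
  obtain s a where s: "strict_mono s" "(\<lambda>n. peaked_map (of_real (y (s n)))) \<longlonglongrightarrow> a"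
    using subseq[of "\<lambda>n. of_real (y n)", OF y1] by blast
  obtain s' b where s': "strict_mono s'" "(\<lambda>n. peaked_map (cnj (centre (s' n)))) \<longlonglongrightarrow> b"
    using subseq[of "\<lambda>n. cnj (centre n)", OF c1] by blast
  have "norm a \<le> majorant_total"
    using tendsto_norm[OF s(2)] norm_peaked_map_real_le[OF y] by (intro LIMSEQ_le_const2) auto
  moreover have "peak - majorant_total \<le> norm b"
    using tendsto_norm[OF s'(2)] norm_peaked_map_at_peak by (intro LIMSEQ_le_const) auto
  \<comment> \<open>\<open>peak - majorant_total\<close> equals \<open>majorant_total + 9\<close>,
    so b lies strictly farther from 0 than a.\<close>
  ultimately have "a \<noteq> b" using majorant_total_nonneg by (auto simp: peak_def)
  have "\<not> visible_domain \<Omega>"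
  proof (rule two_limits_imp_not_visible[OF hol bij y1 _ s(2) c1 _ s'(2) _ \<open>a \<noteq> b\<close>])
    show "(\<lambda>n. complex_of_real (y (s n))) \<longlonglongrightarrow> 1"
      using LIMSEQ_subseq_LIMSEQ[OF y_lim s(1)] by (simp add: comp_def)
    show "(\<lambda>n. cnj (centre (s' n))) \<longlonglongrightarrow> 1"
      using LIMSEQ_subseq_LIMSEQ[OF c_lim s'(1)] by (simp add: comp_def)
    show "complex_of_real (y (s n)) \<noteq> cnj (centre (s' n))" for n
      using gap(1)[of "s' n"] by (auto simp: complex_eq_iff)
  qed
  moreover have "\<Omega> \<noteq> {}" by (simp add: \<Omega>_def)
  ultimately show ?thesis using op conn bdd sc dw by blast
qed

end
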